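(* For every non-negative even number $k$, the Alexander polynomials of the pretzel links $P(k;k+4,k+3,k+5)$ and $P(k+6;k+2,k+1,k+3)$ are distinct: $$\Delta_{P(k;k+4,k+3,k+5)}\neq\Delta_{P(k+6;k+2,k+1,k+3)}.$$
   Context: Pretzel links: for positive integers $p_1,\dots,p_n$, $D(p_1,\dots,p_n)$ is the standard pretzel diagram consisting of $n$ vertical columns placed from left to right, the $i$-th column being two vertical strands twisted around each other with $p_i$ crossings stacked vertically, where at every crossing the over-strand runs from lower left to upper right. For $1\le i<n$ the upper-right end of column $i$ is joined to the upper-left end of column $i+1$ and the lower-right end of column $i$ to the lower-left end of column $i+1$; the upper-left end of column $1$ is joined to the upper-right end of column $n$ by an arc passing above everything, and the lower-left end of column $1$ is joined to the lower-right end of column $n$ by an arc passing below everything. $P(p_1,\dots,p_n)$ is the link represented by $D(p_1,\dots,p_n)$. For $m\ge 0$, $P(m;p_1,\dots,p_n)$ denotes $P(1,\dots,1,p_1,\dots,p_n)$ with $m$ initial entries equal to $1$ (so $P(0;p_1,\dots,p_n)=P(p_1,\dots,p_n)$). The links in the claim are (alternating) knots. $\Delta_K$ denotes the Alexander polynomial of a knot $K$, as usual defined up to multiplication by units $\pm t^n$ of $\mathbb{Z}[t,t^{-1}]$; "distinct" means not equal up to such units. *)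

theory Defs
  imports
    "HOL-Computational_Algebra.Polynomial_Factorial"
    "Jordan_Normal_Form.Determinant"
begin

section \<open>Link diagrams\<close>

datatype corner = LL | LR | UR | UL

text \<open>
  Every crossing is drawn so that its over-strand joins the lower left to the upper right end and
  its under-strand the lower right to the upper left end.  The ends of the crossing, in
  counterclockwise order, are then \<open>LL, LR, UR, UL\<close>.  A diagram is given by its crossings and by the
  involution \<open>glue\<close> that says which ends are joined by an arc of the plane running between crossings.
\<close>

type_synonym 'c strand_end = "'c \<times> corner"

record 'c diagram =
  crossings :: "'c set"
  glue :: "'c strand_end \<Rightarrow> 'c strand_end"

definition strand_ends :: "'c diagram \<Rightarrow> 'c strand_end set" where
  "strand_ends D = crossings D \<times> UNIV"

fun opposite :: "corner \<Rightarrow> corner" where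
  "opposite LL = UR"
| "opposite UR = LL"
| "opposite LR = UL"
| "opposite UL = LR"

definition is_diagram :: "'c diagram \<Rightarrow> bool" where
  "is_diagram D \<longleftrightarrow> finite (crossings D) \<and>
     (\<forall>e \<in> strand_ends D. glue D e \<in> strand_ends D \<and> glue D e \<noteq> e \<and> glue D (glue D e) = e)"

text \<open>\<open>\<omega> e\<close> means that the oriented strand leaves its crossing through the end \<open>e\<close>.\<close>

definition is_orientation :: "'c diagram \<Rightarrow> ('c strand_end \<Rightarrow> bool) \<Rightarrow> bool" where
  "is_orientation D \<omega> \<longleftrightarrow>
     (\<forall>e \<in> strand_ends D. \<omega> (glue D e) \<noteq> \<omega> e) \<and>
     (\<forall>c \<in> crossings D. \<forall>s. \<omega> (c, opposite s) \<noteq> \<omega> (c, s))"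

section \<open>The Alexander polynomial\<close>

text \<open>
  The arcs of a diagram (the generators of the Wirtinger presentation) run from under-crossing to
  under-crossing; each one is represented by the set of all strand ends lying on it.
\<close>

definition arc_steps :: "'c diagram \<Rightarrow> 'c strand_end rel" where
  "arc_steps D = {(e, glue D e) |e. e \<in> strand_ends D} \<union>
                 {((c, LL), (c, UR)) |c. c \<in> crossings D}"

definition arc_of :: "'c diagram \<Rightarrow> 'c strand_end \<Rightarrow> 'c strand_end set" where
  "arc_of D e = {e'. (e, e') \<in> (arc_steps D \<union> (arc_steps D)\<inverse>)\<^sup>*}"

definition arcs :: "'c diagram \<Rightarrow> 'c strand_end set set" where
  "arcs D = arc_of D ` strand_ends D"

definition over_arc :: "'c diagram \<Rightarrow> 'c \<Rightarrow> 'c strand_end set" where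
  "over_arc D c = arc_of D (c, LL)"

text \<open>The under-crossing arcs to the left and to the right of the oriented over-strand.\<close>

definition left_arc :: "'c diagram \<Rightarrow> ('c strand_end \<Rightarrow> bool) \<Rightarrow> 'c \<Rightarrow> 'c strand_end set" where
  "left_arc D \<omega> c = arc_of D (c, if \<omega> (c, UR) then UL else LR)"

definition right_arc :: "'c diagram \<Rightarrow> ('c strand_end \<Rightarrow> bool) \<Rightarrow> 'c \<Rightarrow> 'c strand_end set" where
  "right_arc D \<omega> c = arc_of D (c, if \<omega> (c, UR) then LR else UL)"

text \<open>
  The Wirtinger relation at a crossing with over-arc \<open>x\<close>, left arc \<open>y\<close> and right arc \<open>z\<close> is
  \<open>x z = y x\<close>.  Its Fox derivatives, with every generator sent to \<open>t\<close>, are \<open>1 - t\<close> for \<open>x\<close>, \<open>-1\<close>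
  for \<open>y\<close> and \<open>t\<close> for \<open>z\<close>; they are added up when some of these arcs coincide.
\<close>

definition alexander_matrix ::
    "'c diagram \<Rightarrow> ('c strand_end \<Rightarrow> bool) \<Rightarrow> 'c \<Rightarrow> 'c strand_end set \<Rightarrow> int poly" where
  "alexander_matrix D \<omega> c a =
     (if a = over_arc D c then [:1, -1:] else 0) +
     (if a = left_arc D \<omega> c then [:-1:] else 0) +
     (if a = right_arc D \<omega> c then [:0, 1:] else 0)"

text \<open>
  The minors of order \<open>m\<close> of a matrix with row set \<open>R\<close> and column set \<open>C\<close>.  No order on the rows and
  columns is fixed, so all minors occur with both signs; repeated rows or columns only add \<open>0\<close>.
\<close>

definition minors :: "nat \<Rightarrow> 'r set \<Rightarrow> 'k set \<Rightarrow> ('r \<Rightarrow> 'k \<Rightarrow> 'a :: comm_ring_1) \<Rightarrow> 'a set" where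
  "minors m R C A = {det (mat m m (\<lambda>(i, j). A (\<rho> i) (\<gamma> j))) |\<rho> \<gamma>.
     \<rho> ` {..<m} \<subseteq> R \<and> \<gamma> ` {..<m} \<subseteq> C}"

text \<open>
  The Alexander polynomial is the greatest common divisor of the first elementary ideal, which is
  generated by the minors of order one less than the number of generators.  The entries of the
  Alexander matrix lie in \<open>\<int>[t]\<close>, and a greatest common divisor in \<open>\<int>[t]\<close> is also one in
  \<open>\<int>[t, t\<^sup>-\<^sup>1]\<close>, so the polynomial ring suffices.
\<close>

definition alexander_polynomial :: "'c diagram \<Rightarrow> ('c strand_end \<Rightarrow> bool) \<Rightarrow> int poly" where
  "alexander_polynomial D \<omega> =
     Gcd (minors (card (arcs D) - 1) (crossings D) (arcs D) (alexander_matrix D \<omega>))"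

text \<open>Equality up to units \<open>\<plusminus>t\<^sup>n\<close> of \<open>\<int>[t, t\<^sup>-\<^sup>1]\<close>.\<close>

definition eq_up_to_units :: "int poly \<Rightarrow> int poly \<Rightarrow> bool" where
  "eq_up_to_units f g \<longleftrightarrow>
     (\<exists>m n. monom 1 m * f = monom 1 n * g \<or> monom 1 m * f = - (monom 1 n * g))"

section \<open>Pretzel diagrams\<close>

text \<open>
  The crossing \<open>(i, j)\<close> is the \<open>j\<close>-th one, counted from the bottom, in the \<open>i\<close>-th column, counted
  from the left; both counts start at \<open>0\<close>.
\<close>

fun pretzel_glue :: "nat list \<Rightarrow> (nat \<times> nat) strand_end \<Rightarrow> (nat \<times> nat) strand_end" where
  "pretzel_glue ps ((i, j), s) =
     (let n = length ps;
          l = (if i = 0 then n - 1 else i - 1);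
          r = (if i + 1 = n then 0 else i + 1)
      in case s of
           UL \<Rightarrow> if j + 1 < ps ! i then ((i, j + 1), LL) else ((l, ps ! l - 1), UR)
         | UR \<Rightarrow> if j + 1 < ps ! i then ((i, j + 1), LR) else ((r, ps ! r - 1), UL)
         | LL \<Rightarrow> if 0 < j then ((i, j - 1), UL) else ((l, 0), LR)
         | LR \<Rightarrow> if 0 < j then ((i, j - 1), UR) else ((r, 0), LL))"

definition pretzel :: "nat list \<Rightarrow> (nat \<times> nat) diagram" where
  "pretzel ps = \<lparr>crossings = {(i, j). i < length ps \<and> j < ps ! i}, glue = pretzel_glue ps\<rparr>"

definition pretzel_ones :: "nat \<Rightarrow> nat list \<Rightarrow> (nat \<times> nat) diagram" where
  "pretzel_ones m ps = pretzel (replicate m 1 @ ps)"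

section \<open>Pretzel diagrams are diagrams and can be oriented\<close>

lemma is_diagram_pretzel:
  assumes "\<forall>p \<in> set ps. 0 < p"
  shows "is_diagram (pretzel ps)"
proof -
  have pos: "0 < ps ! i" if "i < length ps" for i
    using assms that by simp
  have "{(i, j). i < length ps \<and> j < ps ! i} = Sigma {..<length ps} (\<lambda>i. {..<ps ! i})"
    by auto
  then have "finite (crossings (pretzel ps))"
    by (simp add: pretzel_def)
  moreover have "pretzel_glue ps ((i, j), s) \<in> strand_ends (pretzel ps) \<and>
      pretzel_glue ps ((i, j), s) \<noteq> ((i, j), s) \<and>
      pretzel_glue ps (pretzel_glue ps ((i, j), s)) = ((i, j), s)"
    if ij: "i < length ps" "j < ps ! i" for i j s
  proof -
    have "ps \<noteq> []" using ij by auto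
    moreover have "length ps - Suc 0 = i" if "Suc i = length ps"
      using that by simp
    ultimately show ?thesis
      using ij pos[of i] pos[of "i - 1"] pos[of "i + 1"] pos[of 0] pos[of "length ps - 1"]
      by (cases s) (auto simp: strand_ends_def pretzel_def Let_def)
  qed
  ultimately show ?thesis
    by (auto simp: is_diagram_def strand_ends_def pretzel_def)
qed

lemma is_orientation_exists:
  assumes D: "is_diagram D"
  shows "\<exists>\<omega>. is_orientation D \<omega>"
proof -
  define E where "E = strand_ends D"
  define g where "g = glue D"
  define a where "a = (\<lambda>(c :: 'a, s). (c, opposite s))"
  define p where "p = a \<circ> g"
  define orb where "orb = (\<lambda>e. {(p ^^ n) e |n. True})"
  define \<omega> where "\<omega> = (\<lambda>e. orb e = (SOME x. x \<in> {orb e, orb (a e)}))"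
  have fin: "finite E"
  proof -
    have "(UNIV :: corner set) = {LL, LR, UR, UL}"
      using corner.exhaust by auto
    then have "finite (UNIV :: corner set)"
      using finite.simps by metis
    then show ?thesis
      using D by (auto simp: E_def strand_ends_def is_diagram_def)
  qed
  have g: "g e \<in> E" "g e \<noteq> e" "g (g e) = e" if "e \<in> E" for e
    using D that by (auto simp: is_diagram_def E_def g_def)
  have aE: "a e \<in> E" if "e \<in> E" for e
    using that by (auto simp: a_def E_def strand_ends_def)
  have a: "a e \<noteq> e" "a (a e) = e" for e
    by (cases e; cases "snd e"; auto simp: a_def)+
  have pE: "p e \<in> E" if "e \<in> E" for e
    using that g aE by (simp add: p_def)
  have pnE: "(p ^^ n) e \<in> E" if "e \<in> E" for e n
    by (induction n) (use that pE in auto)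
  have apart: "e \<in> E \<Longrightarrow> a e \<noteq> (p ^^ n) e" for e n
  proof (induction n arbitrary: e rule: nat_less_induct)
    case (1 n)
    consider "n = 0" | "n = 1" | m where "n = Suc (Suc m)"
      by (metis One_nat_def not0_implies_Suc)
    then show ?case
    proof cases
      case 1
      then show ?thesis using a by simp
    next
      case 2
      then show ?thesis using a(2) g(2)[OF 1(2)] by (simp add: p_def) (metis a(2))
    next
      case (3 m)
      show ?thesis
      proof
        assume "a e = (p ^^ n) e"
        then have "a e = p ((p ^^ m) (p e))"
          using 3 by (simp add: funpow_swap1)
        then have "e = g ((p ^^ m) (p e))"
          by (metis a(2) comp_apply p_def)
        then have "g e = (p ^^ m) (p e)"
          using g(3) pnE pE 1(2) by metis
        moreover have "a (p e) = g e"
          by (simp add: p_def a)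
        ultimately show False
          using 1 3 pE by (metis less_Suc_eq)
      qed
    qed
  qed
  have orbp: "orb (p e) = orb e" if e: "e \<in> E" for e
  proof -
    have "\<not> inj (\<lambda>n. (p ^^ n) e)"
      using fin pnE[OF e] finite_subset[of "range (\<lambda>n. (p ^^ n) e)" E] finite_imageD
      by (metis image_subset_iff infinite_UNIV_nat)
    then obtain m n where mn: "m < n" "(p ^^ m) e = (p ^^ n) e"
      by (metis (no_types, lifting) injI linorder_neqE_nat)
    have inj: "x = y" if "x \<in> E" "y \<in> E" "p x = p y" for x y
      using that a(2) g(3) by (metis comp_apply p_def)
    have injn: "(p ^^ k) x = (p ^^ k) y \<Longrightarrow> x \<in> E \<Longrightarrow> y \<in> E \<Longrightarrow> x = y" for k x y
      by (induction k) (use inj pnE in auto)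
    define k where "k = n - m - 1"
    have "n = m + Suc k" using mn by (simp add: k_def)
    then have "(p ^^ m) e = (p ^^ m) ((p ^^ Suc k) e)"
      using mn(2) by (metis comp_apply funpow_add)
    then have "e = (p ^^ Suc k) e"
      using injn e pnE by blast
    then have per: "e = (p ^^ k) (p e)"
      by (simp add: funpow_swap1)
    show ?thesis
    proof
      show "orb (p e) \<subseteq> orb e"
        unfolding orb_def by (smt (verit) Collect_mono comp_apply funpow_Suc_right)
      show "orb e \<subseteq> orb (p e)"
      proof
        fix x assume "x \<in> orb e"
        then obtain l where "x = (p ^^ l) e" by (auto simp: orb_def)
        then have "x = (p ^^ (l + k)) (p e)"
          using per by (metis comp_apply funpow_add)
        then show "x \<in> orb (p e)" by (auto simp: orb_def)
      qed
    qed
  qed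
  have distinct: "orb e \<noteq> orb (a e)" if "e \<in> E" for e
  proof
    assume "orb e = orb (a e)"
    moreover have "a e \<in> orb (a e)"
      unfolding orb_def by (rule CollectI, rule exI[of _ 0]) simp
    ultimately show False
      using apart[OF that] by (auto simp: orb_def)
  qed
  have flip: "\<omega> (a e) \<noteq> \<omega> e" if "e \<in> E" for e
  proof -
    have "(SOME x. x \<in> {orb e, orb (a e)}) \<in> {orb e, orb (a e)}"
      by (rule someI) auto
    moreover have "{orb (a e), orb (a (a e))} = {orb e, orb (a e)}"
      using a by auto
    ultimately show ?thesis
      unfolding \<omega>_def using distinct[OF that] by auto
  qed
  have "\<omega> (g e) \<noteq> \<omega> e" if e: "e \<in> E" for e
  proof -
    have 1: "orb (a (g e)) = orb e"
      using orbp[OF e] by (simp add: p_def)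
    have "p (g e) = a e"
      using g(3)[OF e] by (simp add: p_def)
    then have "orb (g e) = orb (a e)"
      using orbp[OF g(1)[OF e]] by simp
    then have "\<omega> (a (g e)) = \<omega> e"
      unfolding \<omega>_def using 1 a by simp
    then show ?thesis
      using flip[OF g(1)[OF e]] by simp
  qed
  moreover have "\<omega> (c, opposite s) \<noteq> \<omega> (c, s)" if "c \<in> crossings D" for c s
    using flip[of "(c, s)"] that by (simp add: a_def E_def strand_ends_def)
  ultimately show ?thesis
    unfolding is_orientation_def E_def g_def by blast
qed

end

theory Submission
  imports Defs "Jordan_Normal_Form.Char_Poly"
begin

text \<open>
  The two knots have the same determinant, but their Alexander polynomials are separated by a real root:
  some \<open>t\<close> with \<open>0 < t < 1\<close> is a root of the second one but not of the first one, and
  multiplication by units cannot change whether a number \<open>t \<noteq> 0\<close> is a root.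

  To decide whether a given \<open>t\<close> is a root no determinant has to be computed.  The Alexander matrix at
  \<open>t\<close> kills the constants, and the Alexander polynomial vanishes at \<open>t\<close> if and only if it also kills
  something else, that is, if the diagram has a non-constant colouring by real numbers with
  \<open>(1 - t) * x - y + t * z = 0\<close> at every crossing (\<open>eval_alexander_polynomial_eq_0\<close>,
  \<open>eval_alexander_polynomial_neq_0\<close>).  In an alternating diagram the arcs correspond to the crossings, so
  these are colourings of the crossings.

  In a pretzel diagram the colour differences along a column are multiplied by \<open>- t\<close> or
  \<open>- 1 / t\<close> from one crossing to the next.  A colouring is therefore given by one difference \<open>d i\<close>
  for each column; the relations between neighbouring columns fix the \<open>d i\<close> up to a common factor, and
  the only remaining condition is that they add up to zero (\<open>pretzel_root_iff\<close>).  For \<open>2 * b\<close> columns with a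
  single crossing followed by columns with \<open>2 * m\<close>, \<open>p\<close> and \<open>q\<close> crossings, \<open>p\<close> and \<open>q\<close> odd,
  the condition becomes
  \<open>m * ((b + 1) * (1 - t)\<^sup>2 / t + rho p t + rho q t) = 1\<close> (\<open>pretzel_root_iff_equation\<close>).

  The left-hand side is \<open>0\<close> at \<open>t = 1\<close> and at least \<open>1\<close> at \<open>t = 1 / 4\<close>, so by the intermediate value
  theorem the equation of the second knot has a solution.  There the left-hand side of
  the first knot exceeds \<open>1\<close>: since \<open>rho (p + 2)\<close> is a simple rational function of \<open>rho p\<close>, this is an
  elementary inequality (\<open>recursion_separates_equations\<close>).
\<close>

section \<open>Real roots of a greatest common divisor of integer polynomials\<close>

definition eval_real :: "real \<Rightarrow> int poly \<Rightarrow> real" where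
  "eval_real t f = poly (map_poly of_int f) t"

lemma eval_real_hom: "comm_ring_hom (eval_real t)"
proof -
  interpret h: map_poly_comm_ring_hom "of_int :: int \<Rightarrow> real" ..
  show ?thesis
    by unfold_locales (simp_all add: eval_real_def hom_distribs)
qed

lemma eval_real_mult: "eval_real t (f * g) = eval_real t f * eval_real t g"
  and eval_real_uminus: "eval_real t (- f) = - eval_real t f"
  and eval_real_add: "eval_real t (f + g) = eval_real t f + eval_real t g"
  and eval_real_0: "eval_real t 0 = 0"
proof -
  interpret h: comm_ring_hom "eval_real t" by (rule eval_real_hom)
  show "eval_real t (f * g) = eval_real t f * eval_real t g"
    "eval_real t (- f) = - eval_real t f"
    "eval_real t (f + g) = eval_real t f + eval_real t g"
    "eval_real t 0 = 0"
    by (simp_all add: hom_distribs)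
qed

lemma eval_real_pCons: "eval_real t (pCons a f) = of_int a + t * eval_real t f"
  by (simp add: eval_real_def of_int_hom.map_poly_pCons_hom)

lemma eval_real_monom: "eval_real t (monom 1 n) = t ^ n"
  by (simp add: eval_real_def map_poly_monom poly_monom)

text \<open>
  A greatest common divisor over \<open>\<int>\<close> is not a combination of the polynomials, so evaluating it needs an
  argument: a primitive polynomial of least degree among those vanishing at \<open>t\<close> divides, by
  pseudo-division and the lemma of Gauss, every polynomial vanishing at \<open>t\<close>, hence also \<open>Gcd S\<close>.
\<close>

lemma eval_real_Gcd_eq_0:
  assumes S: "\<And>f. f \<in> S \<Longrightarrow> eval_real t f = 0"
  shows "eval_real t (Gcd S) = 0"
proof (cases "S \<subseteq> {0}")
  case True
  then have "Gcd S = 0" by simp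
  then show ?thesis by (simp only: eval_real_0)
next
  case False
  define V where "V = (\<lambda>f. f \<noteq> 0 \<and> eval_real t f = 0)"
  have "\<exists>f. V f" using False S by (auto simp: V_def)
  then obtain f where f: "V f" and min: "\<And>g. V g \<Longrightarrow> degree f \<le> degree g"
    using arg_min_nat_lemma[of V _ degree] by metis
  define g where "g = primitive_part f"
  have g0: "g \<noteq> 0" and deg: "degree g = degree f" using f by (simp_all add: g_def V_def)
  have gf: "f = [:content f:] * g" by (simp add: g_def)
  have "eval_real t f = of_int (content f) * eval_real t g"
    by (subst gf, subst eval_real_mult) (simp add: eval_real_pCons eval_real_0)
  moreover have "content f \<noteq> 0" using f by (simp add: V_def)
  ultimately have tg: "eval_real t g = 0" using f by (simp add: V_def)
  have "g dvd h" if h: "eval_real t h = 0" for h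
  proof -
    obtain a q where a: "a \<noteq> 0" and eq: "smult a h = g * q + pseudo_mod h g"
      and r: "pseudo_mod h g = 0 \<or> degree (pseudo_mod h g) < degree g"
      using pseudo_mod[OF g0] by blast
    have "smult a h = [:a:] * h" by simp
    then have "[:a:] * h = g * q + pseudo_mod h g" using eq by simp
    from arg_cong[OF this, of "eval_real t"] have "eval_real t (pseudo_mod h g) = 0"
      using h tg by (simp add: eval_real_mult eval_real_add del: mult_pCons_left)
    then have "pseudo_mod h g = 0"
      using r min[of "pseudo_mod h g"] deg by (force simp: V_def)
    then have "g dvd smult a h" using eq by simp
    then have "primitive_part g dvd primitive_part (smult a h)"
      by (rule primitive_part_dvd_primitive_partI)
    moreover have "primitive_part g = g"
      unfolding g_def using f by (intro primitive_part_prim content_primitive_part) (simp add: V_def)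
    ultimately have "g dvd primitive_part h"
      using a by (simp add: primitive_part_smult sgn_if split: if_splits)
    moreover have "primitive_part h dvd h"
      by (metis content_times_primitive_part dvd_smult dvd_refl)
    ultimately show ?thesis by (rule dvd_trans)
  qed
  then have "g dvd Gcd S" using S by (intro Gcd_greatest) auto
  then show ?thesis using tg by (auto simp: dvd_def eval_real_mult)
qed

section \<open>First minors and kernels\<close>

lemma det_eq_0_iff_kernel:
  fixes A :: "'r \<Rightarrow> 'k \<Rightarrow> 'a :: field"
  assumes \<rho>: "\<rho> ` {..<m} = R" and \<gamma>: "bij_betw \<gamma> {..<m} C"
  shows "det (mat m m (\<lambda>(i, j). A (\<rho> i) (\<gamma> j))) = 0 \<longleftrightarrow>
    (\<exists>v. (\<exists>c \<in> C. v c \<noteq> 0) \<and> (\<forall>r \<in> R. (\<Sum>c \<in> C. A r c * v c) = 0))"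
    (is "det ?M = 0 \<longleftrightarrow> ?rhs")
proof -
  have M: "?M \<in> carrier_mat m m" by simp
  have prod: "(?M *\<^sub>v w) $ i = (\<Sum>c \<in> C. A (\<rho> i) c * v c)"
    if "w \<in> carrier_vec m" "i < m" "\<And>j. j < m \<Longrightarrow> w $ j = v (\<gamma> j)" for w v i
  proof -
    have "(?M *\<^sub>v w) $ i = (\<Sum>j \<in> {..<m}. A (\<rho> i) (\<gamma> j) * v (\<gamma> j))"
      using that by (simp add: scalar_prod_def atLeast0LessThan)
    also have "\<dots> = (\<Sum>c \<in> C. A (\<rho> i) c * v c)"
      by (rule sum.reindex_bij_betw[OF \<gamma>, of "\<lambda>c. A (\<rho> i) c * v c"])
    finally show ?thesis .
  qed
  show ?thesis
  proof
    assume "det ?M = 0"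
    then obtain w where w: "w \<in> carrier_vec m" "w \<noteq> 0\<^sub>v m" "?M *\<^sub>v w = 0\<^sub>v m"
      using det_0_iff_vec_prod_zero_field[OF M] by blast
    define v where "v = (\<lambda>c. w $ (the_inv_into {..<m} \<gamma> c))"
    have v: "w $ j = v (\<gamma> j)" if "j < m" for j
      using that \<gamma> by (simp add: v_def bij_betw_def the_inv_into_f_f)
    obtain j where j: "j < m" "w $ j \<noteq> 0" using w(1,2) by (metis carrier_vecD eq_vecI index_zero_vec)
    have "\<forall>r \<in> R. (\<Sum>c \<in> C. A r c * v c) = 0"
    proof
      fix r assume "r \<in> R"
      then obtain i where i: "i < m" "r = \<rho> i" using \<rho> by auto
      from prod[OF w(1) i(1) v] show "(\<Sum>c \<in> C. A r c * v c) = 0" using w(3) i by simp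
    qed
    moreover have "\<gamma> j \<in> C" using \<gamma> j by (auto simp: bij_betw_def)
    ultimately show ?rhs using j v by (intro exI[of _ v]) auto
  next
    assume ?rhs
    then obtain v c where v: "c \<in> C" "v c \<noteq> 0" "\<forall>r \<in> R. (\<Sum>c \<in> C. A r c * v c) = 0" by blast
    define w where "w = vec m (\<lambda>j. v (\<gamma> j))"
    obtain j where "j < m" "c = \<gamma> j" using v(1) \<gamma> by (auto simp: bij_betw_def)
    then have "w \<noteq> 0\<^sub>v m" using v(2) by (auto simp: w_def vec_eq_iff)
    moreover have "?M *\<^sub>v w = 0\<^sub>v m"
    proof (rule eq_vecI)
      fix i assume "i < dim_vec (0\<^sub>v m :: 'a vec)"
      then have i: "i < m" by simp
      have "(?M *\<^sub>v w) $ i = (\<Sum>c \<in> C. A (\<rho> i) c * v c)"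
        by (rule prod) (use i in \<open>simp_all add: w_def\<close>)
      then show "(?M *\<^sub>v w) $ i = 0\<^sub>v m $ i" using v(3) i \<rho> by auto
    qed simp
    moreover have "w \<in> carrier_vec m" by (simp add: w_def)
    ultimately show "det ?M = 0" using det_0_iff_vec_prod_zero_field[OF M] by blast
  qed
qed

text \<open>
  Subtracting a constant from a non-constant kernel vector makes it vanish on the single column
  that a minor omits, without making it zero on the remaining ones.
\<close>

lemma first_minors_eq_0:
  fixes A :: "'r \<Rightarrow> 'k \<Rightarrow> 'a :: field"
  assumes C: "finite C"
    and const: "\<And>r. r \<in> R \<Longrightarrow> (\<Sum>c \<in> C. A r c) = 0"
    and v: "\<And>r. r \<in> R \<Longrightarrow> (\<Sum>c \<in> C. A r c * v c) = 0"
    and nonconst: "a \<in> C" "b \<in> C" "v a \<noteq> v b"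
    and d: "d \<in> minors (card C - 1) R C A"
  shows "d = 0"
proof -
  define m where "m = card C - 1"
  obtain \<rho> \<gamma> where d: "d = det (mat m m (\<lambda>(i, j). A (\<rho> i) (\<gamma> j)))"
    and sub: "\<rho> ` {..<m} \<subseteq> R" "\<gamma> ` {..<m} \<subseteq> C"
    using d by (auto simp: minors_def m_def)
  have "card C \<noteq> 0" using nonconst C by auto
  then have cardC: "card C = Suc m" by (simp add: m_def)
  show ?thesis
  proof (cases "inj_on \<gamma> {..<m}")
    case False
    then obtain i j where ij: "i < m" "j < m" "i \<noteq> j" "\<gamma> i = \<gamma> j" by (auto simp: inj_on_def)
    show ?thesis unfolding d
      by (rule det_identical_columns[of _ m i j]) (use ij in \<open>auto intro!: eq_vecI\<close>)
  next
    case True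
    define C' where "C' = \<gamma> ` {..<m}"
    have bij: "bij_betw \<gamma> {..<m} C'" using True by (simp add: bij_betw_def C'_def)
    have "card C' = m" using True by (simp add: C'_def card_image)
    then obtain c0 where c0: "c0 \<in> C" "c0 \<notin> C'"
      using cardC sub by (metis C'_def n_not_Suc_n subsetI subset_antisym)
    have "card (insert c0 C') = card C"
      using c0 \<open>card C' = m\<close> cardC by (simp add: C'_def)
    then have CC: "C = insert c0 C'"
      using c0 sub C by (metis C'_def card_subset_eq insert_subset)
    \<comment> \<open>\<open>c0\<close> is the column that the minor omits.\<close>
    define u where "u = (\<lambda>c. v c - v c0)"
    have "(\<Sum>c \<in> C'. A r c * u c) = 0" if "r \<in> R" for r
    proof -
      have "(\<Sum>c \<in> C. A r c * u c) = (\<Sum>c \<in> C. A r c * v c) - (\<Sum>c \<in> C. A r c) * v c0"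
        by (simp add: u_def algebra_simps sum_subtractf sum_distrib_left)
      then have "(\<Sum>c \<in> C. A r c * u c) = 0" using const v that by simp
      then show ?thesis using CC c0 C by (simp add: u_def)
    qed
    moreover have "\<exists>c \<in> C'. u c \<noteq> 0" using nonconst CC unfolding u_def by (metis insert_iff right_minus_eq)
    ultimately show ?thesis unfolding d
      using det_eq_0_iff_kernel[OF refl bij, where \<rho> = \<rho> and A = A] sub by blast
  qed
qed

text \<open>
  A square matrix whose kernel consists of the constants is singular, so its rows satisfy a linear
  relation.  A row occurring in it can be deleted without enlarging the kernel, and deleting any
  column then removes the constants from the kernel.
\<close>

lemma first_minor_neq_0:
  fixes A :: "'r \<Rightarrow> 'k \<Rightarrow> real"
  assumes fin: "finite R" "finite C" "card R = card C" "C \<noteq> {}"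
    and const: "\<And>r. r \<in> R \<Longrightarrow> (\<Sum>c \<in> C. A r c) = 0"
    and kernel: "\<And>v a b. (\<And>r. r \<in> R \<Longrightarrow> (\<Sum>c \<in> C. A r c * v c) = 0) \<Longrightarrow>
      a \<in> C \<Longrightarrow> b \<in> C \<Longrightarrow> v a = v b"
  shows "\<exists>d \<in> minors (card C - 1) R C A. d \<noteq> 0"
proof -
  define n where "n = card C"
  obtain f g where fg: "bij_betw f {..<n} R" "bij_betw g {..<n} C"
    using fin ex_bij_betw_nat_finite[of R] ex_bij_betw_nat_finite[of C]
    by (auto simp: n_def atLeast0LessThan)
  have fg': "f ` {..<n} = R" "g ` {..<n} = C" using fg by (auto simp: bij_betw_def)
  define F where "F = mat n n (\<lambda>(i, j). A (f i) (g j))"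
  have "det F = 0"
    unfolding F_def det_eq_0_iff_kernel[OF fg'(1) fg(2)]
    using const fin by (intro exI[of _ "\<lambda>_. 1"]) auto
  then have "det (transpose_mat F) = 0" by (subst det_transpose[of F n]) (simp_all add: F_def)
  moreover have "transpose_mat F = mat n n (\<lambda>(i, j). A (f j) (g i))"
    by (auto simp: F_def)
  ultimately obtain w r0 where w: "r0 \<in> R" "w r0 \<noteq> 0"
      "\<And>c. c \<in> C \<Longrightarrow> (\<Sum>r \<in> R. A r c * w r) = 0"
    using det_eq_0_iff_kernel[OF fg'(2) fg(1), where A = "\<lambda>c r. A r c"] by auto
  obtain c0 where c0: "c0 \<in> C" using fin by auto
  have "card (R - {r0}) = n - 1" "card (C - {c0}) = n - 1" "finite (R - {r0})" "finite (C - {c0})"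
    using fin w c0 by (simp_all add: n_def)
  then obtain \<rho> \<gamma> where rg: "bij_betw \<rho> {..<n-1} (R - {r0})" "bij_betw \<gamma> {..<n-1} (C - {c0})"
    using ex_bij_betw_nat_finite[of "R - {r0}"] ex_bij_betw_nat_finite[of "C - {c0}"]
    by (auto simp: atLeast0LessThan)
  have rg': "\<rho> ` {..<n-1} = R - {r0}" "\<gamma> ` {..<n-1} = C - {c0}"
    using rg by (auto simp: bij_betw_def)
  define M where "M = mat (n-1) (n-1) (\<lambda>(i, j). A (\<rho> i) (\<gamma> j))"
  have "det M \<noteq> 0"
  proof
    assume "det M = 0"
    then obtain v c where v: "c \<in> C - {c0}" "v c \<noteq> 0"
      "\<And>r. r \<in> R - {r0} \<Longrightarrow> (\<Sum>c \<in> C - {c0}. A r c * v c) = 0"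
      unfolding M_def det_eq_0_iff_kernel[OF rg'(1) rg(2)] by blast
    define u where "u = v(c0 := 0)"
    have u: "(\<Sum>c \<in> C. A r c * u c) = (\<Sum>c \<in> C - {c0}. A r c * v c)" for r
      using fin c0 by (simp add: sum.remove[of C c0] u_def)
    have "0 = (\<Sum>c \<in> C. (\<Sum>r \<in> R. A r c * w r) * u c)" using w by simp
    also have "\<dots> = (\<Sum>r \<in> R. w r * (\<Sum>c \<in> C. A r c * u c))"
      unfolding sum_distrib_left sum_distrib_right
      by (subst sum.swap) (simp add: mult_ac)
    also have "\<dots> = w r0 * (\<Sum>c \<in> C. A r0 c * u c)"
      using fin w v u by (simp add: sum.remove[of R r0])
    finally have "(\<Sum>c \<in> C. A r0 c * u c) = 0" using w by simp
    then have "u c = u c0"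
      using v u c0 by (intro kernel) (metis DiffI singletonD, auto)
    then show False using v by (simp add: u_def)
  qed
  moreover have "det M \<in> minors (card C - 1) R C A"
    unfolding minors_def M_def using rg' by (force simp: n_def)
  ultimately show ?thesis by blast
qed

lemma eval_real_minors:
  "eval_real t ` minors m R C A = minors m R C (\<lambda>r c. eval_real t (A r c))"
proof -
  interpret h: comm_ring_hom "eval_real t" by (rule eval_real_hom)
  have "eval_real t (det (mat m m (\<lambda>(i, j). A (\<rho> i) (\<gamma> j)))) =
      det (mat m m (\<lambda>(i, j). eval_real t (A (\<rho> i) (\<gamma> j))))" for \<rho> \<gamma>
    unfolding h.hom_det[symmetric] by (rule arg_cong[where f = det]) auto
  then show ?thesis unfolding minors_def by (auto simp: image_iff) metis+
qed


section \<open>Colourings of alternating diagrams\<close>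

definition is_over :: "corner \<Rightarrow> bool" where
  "is_over s \<longleftrightarrow> s = LL \<or> s = UR"

definition alternating :: "'c diagram \<Rightarrow> bool" where
  "alternating D \<longleftrightarrow> is_diagram D \<and>
     (\<forall>e \<in> strand_ends D. is_over (snd (glue D e)) \<longleftrightarrow> \<not> is_over (snd e))"

text \<open>
  In an alternating diagram every arc passes over exactly one crossing, and this crossing serves as
  a name of the arc.
\<close>

definition over_crossing :: "'c diagram \<Rightarrow> 'c strand_end \<Rightarrow> 'c" where
  "over_crossing D e = (if is_over (snd e) then fst e else fst (glue D e))"

lemma arc_of_eq_iff:
  "arc_of D e = arc_of D e' \<longleftrightarrow> (e, e') \<in> (arc_steps D \<union> (arc_steps D)\<inverse>)\<^sup>*"
proof -
  have sym: "sym ((arc_steps D \<union> (arc_steps D)\<inverse>)\<^sup>*)"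
    by (intro sym_rtrancl sym_Un_converse)
  show ?thesis
  proof
    assume "arc_of D e = arc_of D e'"
    moreover have "e' \<in> arc_of D e'" by (simp add: arc_of_def)
    ultimately have "e' \<in> arc_of D e" by simp
    then show "(e, e') \<in> (arc_steps D \<union> (arc_steps D)\<inverse>)\<^sup>*" by (simp add: arc_of_def)
  next
    assume "(e, e') \<in> (arc_steps D \<union> (arc_steps D)\<inverse>)\<^sup>*"
    then show "arc_of D e = arc_of D e'"
      unfolding arc_of_def using symD[OF sym, of e e'] by (blast intro: rtrancl_trans)
  qed
qed

lemma arc_of_eqI: "(e, e') \<in> arc_steps D \<Longrightarrow> arc_of D e = arc_of D e'"
  unfolding arc_of_eq_iff by auto

context
  fixes D :: "'c diagram"
  assumes alt: "alternating D"
begin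

lemma glue_end:
  assumes "e \<in> strand_ends D"
  shows "glue D e \<in> strand_ends D" "glue D (glue D e) = e"
    "is_over (snd (glue D e)) \<longleftrightarrow> \<not> is_over (snd e)"
  using alt assms by (auto simp: alternating_def is_diagram_def)

lemma over_crossing_in: "e \<in> strand_ends D \<Longrightarrow> over_crossing D e \<in> crossings D"
  using glue_end(1)[of e] by (auto simp: over_crossing_def strand_ends_def mem_Times_iff)

text \<open>
  Gluing joins an end of an over-strand to an end of an under-strand, so gluing
  two ends and following an over-strand both preserve \<open>over_crossing\<close>; conversely these two steps lead
  from any end to the over-strand of that crossing.
\<close>

lemma arc_of_eq_iff_over_crossing:
  assumes e: "e \<in> strand_ends D" and e': "e' \<in> strand_ends D"
  shows "arc_of D e = arc_of D e' \<longleftrightarrow> over_crossing D e = over_crossing D e'"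
proof
  have step: "over_crossing D x = over_crossing D y" if "(x, y) \<in> arc_steps D" for x y
    using that unfolding arc_steps_def
  proof (elim UnE)
    assume "(x, y) \<in> {(e, glue D e) |e. e \<in> strand_ends D}"
    then show ?thesis using glue_end[of x] by (auto simp: over_crossing_def)
  qed (auto simp: over_crossing_def is_over_def)
  assume "arc_of D e = arc_of D e'"
  then have "(e, e') \<in> (arc_steps D \<union> (arc_steps D)\<inverse>)\<^sup>*" by (simp add: arc_of_eq_iff)
  then show "over_crossing D e = over_crossing D e'"
    by induction (use step in auto)
next
  have over: "arc_of D x = arc_of D (fst x, LL)" if "x \<in> strand_ends D" "is_over (snd x)" for x
  proof (cases "snd x = LL")
    case True
    then show ?thesis by (metis prod.collapse)
  next
    case False
    then have "((fst x, LL), x) \<in> arc_steps D"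
      using that by (auto simp: arc_steps_def is_over_def strand_ends_def mem_Times_iff
          intro: prod.expand)
    then show ?thesis by (rule arc_of_eqI[symmetric])
  qed
  have main: "arc_of D x = arc_of D (over_crossing D x, LL)" if x: "x \<in> strand_ends D" for x
  proof (cases "is_over (snd x)")
    case True
    then show ?thesis using over x by (simp add: over_crossing_def)
  next
    case False
    have "arc_of D x = arc_of D (glue D x)"
      by (rule arc_of_eqI) (unfold arc_steps_def, use x in blast)
    then show ?thesis using over[of "glue D x"] glue_end[OF x] False
      by (simp add: over_crossing_def)
  qed
  assume "over_crossing D e = over_crossing D e'"
  then show "arc_of D e = arc_of D e'" using main[OF e] main[OF e'] by simp
qed

lemma bij_betw_over_arc: "bij_betw (over_arc D) (crossings D) (arcs D)"
proof -
  have end_in: "(c, s) \<in> strand_ends D" if "c \<in> crossings D" for c s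
    using that by (simp add: strand_ends_def)
  have oc: "over_crossing D (c, LL) = c" for c by (simp add: over_crossing_def is_over_def)
  have "inj_on (over_arc D) (crossings D)"
    by (rule inj_onI) (simp add: over_arc_def arc_of_eq_iff_over_crossing end_in oc)
  moreover have "arcs D \<subseteq> over_arc D ` crossings D"
  proof
    fix a assume "a \<in> arcs D"
    then obtain e where e: "e \<in> strand_ends D" "a = arc_of D e" by (auto simp: arcs_def)
    then have "a = over_arc D (over_crossing D e)"
      using over_crossing_in[OF e(1)] end_in
      by (simp add: over_arc_def arc_of_eq_iff_over_crossing oc)
    then show "a \<in> over_arc D ` crossings D" using over_crossing_in[OF e(1)] by blast
  qed
  moreover have "over_arc D ` crossings D \<subseteq> arcs D"
    using end_in by (auto simp: arcs_def over_arc_def)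
  ultimately show ?thesis by (auto simp: bij_betw_def)
qed

lemma arc_of_eq_over_arc:
  assumes "e \<in> strand_ends D"
  shows "arc_of D e = over_arc D (over_crossing D e)"
proof -
  have "(over_crossing D e, LL) \<in> strand_ends D"
    using over_crossing_in[OF assms] by (simp add: strand_ends_def)
  then show ?thesis
    using assms by (simp add: over_arc_def arc_of_eq_iff_over_crossing over_crossing_def is_over_def)
qed

end

text \<open>
  A kernel vector of the Alexander matrix at \<open>t\<close>, with every arc replaced by its over-crossing.
\<close>

definition is_colouring ::
    "'c diagram \<Rightarrow> ('c strand_end \<Rightarrow> bool) \<Rightarrow> real \<Rightarrow> ('c \<Rightarrow> real) \<Rightarrow> bool" where
  "is_colouring D \<omega> t x \<longleftrightarrow> (\<forall>c \<in> crossings D.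
     (1 - t) * x c - x (over_crossing D (c, if \<omega> (c, UR) then UL else LR))
       + t * x (over_crossing D (c, if \<omega> (c, UR) then LR else UL)) = 0)"

lemma alexander_matrix_row_sum:
  assumes alt: "alternating D" and c: "c \<in> crossings D"
  shows "(\<Sum>a \<in> arcs D. eval_real t (alexander_matrix D \<omega> c a) * v a) =
    (1 - t) * v (over_arc D c)
      - v (over_arc D (over_crossing D (c, if \<omega> (c, UR) then UL else LR)))
      + t * v (over_arc D (over_crossing D (c, if \<omega> (c, UR) then LR else UL)))"
proof -
  have ends: "(c, s) \<in> strand_ends D" for s using c by (simp add: strand_ends_def)
  have bij: "bij_betw (over_arc D) (crossings D) (arcs D)" by (rule bij_betw_over_arc[OF alt])
  have fin: "finite (arcs D)"
    using bij alt by (auto simp: alternating_def is_diagram_def dest: bij_betw_finite)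
  have left: "left_arc D \<omega> c = over_arc D (over_crossing D (c, if \<omega> (c, UR) then UL else LR))"
    and right: "right_arc D \<omega> c = over_arc D (over_crossing D (c, if \<omega> (c, UR) then LR else UL))"
    unfolding left_arc_def right_arc_def by (rule arc_of_eq_over_arc[OF alt ends])+
  have "arc_of D (c, s) \<in> arcs D" for s using ends by (simp add: arcs_def)
  then have mem: "over_arc D c \<in> arcs D" "left_arc D \<omega> c \<in> arcs D" "right_arc D \<omega> c \<in> arcs D"
    by (simp_all add: over_arc_def left_arc_def right_arc_def)
  have "(\<Sum>a \<in> arcs D. eval_real t (alexander_matrix D \<omega> c a) * v a) =
      (\<Sum>a \<in> arcs D. (if a = over_arc D c then (1 - t) * v a else 0)
        + (if a = left_arc D \<omega> c then - v a else 0)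
        + (if a = right_arc D \<omega> c then t * v a else 0))"
    by (rule sum.cong)
      (auto simp: alexander_matrix_def eval_real_add eval_real_pCons eval_real_0 algebra_simps)
  also have "\<dots> = (1 - t) * v (over_arc D c) - v (left_arc D \<omega> c) + t * v (right_arc D \<omega> c)"
    using fin mem by (simp add: sum.distrib)
  finally show ?thesis by (simp only: left right)
qed

text \<open>
  A non-constant colouring is a second kernel vector besides the constants, so all the minors whose
  greatest common divisor is the Alexander polynomial vanish at \<open>t\<close>.
\<close>

theorem eval_alexander_polynomial_eq_0:
  assumes alt: "alternating D" and x: "is_colouring D \<omega> t x"
    and ab: "a \<in> crossings D" "b \<in> crossings D" "x a \<noteq> x b"
  shows "eval_real t (alexander_polynomial D \<omega>) = 0"
  unfolding alexander_polynomial_def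
proof (rule eval_real_Gcd_eq_0)
  fix f assume f: "f \<in> minors (card (arcs D) - 1) (crossings D) (arcs D) (alexander_matrix D \<omega>)"
  define v where "v = (\<lambda>a. x (the_inv_into (crossings D) (over_arc D) a))"
  have bij: "bij_betw (over_arc D) (crossings D) (arcs D)" by (rule bij_betw_over_arc[OF alt])
  have v: "v (over_arc D c) = x c" if "c \<in> crossings D" for c
    using that bij by (simp add: v_def bij_betw_def the_inv_into_f_f)
  have oc: "over_crossing D (c, s) \<in> crossings D" if "c \<in> crossings D" for c s
    using that by (intro over_crossing_in[OF alt]) (simp add: strand_ends_def)
  show "eval_real t f = 0"
  proof (rule first_minors_eq_0)
    show "finite (arcs D)"
      using bij alt by (auto simp: alternating_def is_diagram_def dest: bij_betw_finite)
    show "(\<Sum>a \<in> arcs D. eval_real t (alexander_matrix D \<omega> c a)) = 0"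
      if "c \<in> crossings D" for c
      using alexander_matrix_row_sum[OF alt that, of t \<omega> "\<lambda>_. 1"] by simp
    show "(\<Sum>a \<in> arcs D. eval_real t (alexander_matrix D \<omega> c a) * v a) = 0"
      if "c \<in> crossings D" for c
      using alexander_matrix_row_sum[OF alt that, of t \<omega> v] x that oc
      by (simp add: is_colouring_def v)
    show "over_arc D a \<in> arcs D" "over_arc D b \<in> arcs D"
      using bij ab by (auto simp: bij_betw_def)
    show "v (over_arc D a) \<noteq> v (over_arc D b)" using ab v by simp
    show "eval_real t f \<in> minors (card (arcs D) - 1) (crossings D) (arcs D)
        (\<lambda>c a. eval_real t (alexander_matrix D \<omega> c a))"
      using f unfolding eval_real_minors[symmetric] by blast
  qed
qed

theorem eval_alexander_polynomial_neq_0: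
  assumes alt: "alternating D" and ne: "crossings D \<noteq> {}"
    and const: "\<And>x a b. is_colouring D \<omega> t x \<Longrightarrow> a \<in> crossings D \<Longrightarrow> b \<in> crossings D \<Longrightarrow> x a = x b"
  shows "eval_real t (alexander_polynomial D \<omega>) \<noteq> 0"
proof -
  let ?M = "minors (card (arcs D) - 1) (crossings D) (arcs D)"
  have bij: "bij_betw (over_arc D) (crossings D) (arcs D)" by (rule bij_betw_over_arc[OF alt])
  have oc: "over_crossing D (c, s) \<in> crossings D" if "c \<in> crossings D" for c s
    using that by (intro over_crossing_in[OF alt]) (simp add: strand_ends_def)
  have "\<exists>d \<in> ?M (\<lambda>c a. eval_real t (alexander_matrix D \<omega> c a)). d \<noteq> 0"
  proof (rule first_minor_neq_0)
    show fin: "finite (crossings D)" using alt by (simp add: alternating_def is_diagram_def)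
    then show "finite (arcs D)" using bij bij_betw_finite by blast
    show "card (crossings D) = card (arcs D)" using bij by (rule bij_betw_same_card)
    show "arcs D \<noteq> {}" using bij ne by (auto simp: bij_betw_def)
    show "(\<Sum>a \<in> arcs D. eval_real t (alexander_matrix D \<omega> c a)) = 0"
      if "c \<in> crossings D" for c
      using alexander_matrix_row_sum[OF alt that, of t \<omega> "\<lambda>_. 1"] by simp
    fix v a b
    assume v: "\<And>c. c \<in> crossings D \<Longrightarrow>
        (\<Sum>a \<in> arcs D. eval_real t (alexander_matrix D \<omega> c a) * v a) = 0"
      and ab: "a \<in> arcs D" "b \<in> arcs D"
    have "is_colouring D \<omega> t (v \<circ> over_arc D)"
      unfolding is_colouring_def comp_def
      by (intro ballI) (simp only: alexander_matrix_row_sum[OF alt, symmetric] v)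
    moreover have surj: "over_arc D ` crossings D = arcs D" using bij by (rule bij_betw_imp_surj_on)
    obtain a' where "a = over_arc D a'" "a' \<in> crossings D"
      using ab(1) unfolding surj[symmetric] by (rule imageE)
    moreover obtain b' where "b = over_arc D b'" "b' \<in> crossings D"
      using ab(2) unfolding surj[symmetric] by (rule imageE)
    ultimately show "v a = v b" using const[of "v \<circ> over_arc D" a' b'] by simp
  qed
  then obtain f where f: "f \<in> ?M (alexander_matrix D \<omega>)" "eval_real t f \<noteq> 0"
    unfolding eval_real_minors[symmetric] by blast
  then have "alexander_polynomial D \<omega> dvd f"
    unfolding alexander_polynomial_def by (intro Gcd_dvd)
  then show ?thesis using f by (auto simp: dvd_def eval_real_mult)
qed


section \<open>Colourings of pretzel diagrams\<close>

definition right_column :: "'a list \<Rightarrow> nat \<Rightarrow> nat" where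
  "right_column ps i = (if i + 1 = length ps then 0 else i + 1)"

definition left_column :: "'a list \<Rightarrow> nat \<Rightarrow> nat" where
  "left_column ps i = (if i = 0 then length ps - 1 else i - 1)"

text \<open>
  Going up a column, the colour differences of consecutive crossings get multiplied by this number at
  each crossing; see \<open>is_colouring_pretzel\<close>.
\<close>

definition crossing_ratio :: "((nat \<times> nat) strand_end \<Rightarrow> bool) \<Rightarrow> real \<Rightarrow> nat \<Rightarrow> nat \<Rightarrow> real" where
  "crossing_ratio \<omega> t i j = (if \<omega> ((i, j), UR) then - t else - (1 / t))"

text \<open>
  If the first difference of a sequence is \<open>d\<close> and the differences then get multiplied by
  \<open>u 0, u 1, \<dots>\<close> in turn, \<open>d * geom_sum u p\<close> is the sum of the differences number \<open>0\<close> to \<open>p - 1\<close>, and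
  \<open>d * shifted_geom_sum u p\<close> is the sum of those number \<open>1\<close> to \<open>p\<close>.  In a column with \<open>p\<close> crossings the
  former leads from the crossing joined to its lower right end to its topmost crossing, the latter from its
  lowest crossing to the one joined to its upper left end.
\<close>

definition geom_sum :: "(nat \<Rightarrow> real) \<Rightarrow> nat \<Rightarrow> real" where
  "geom_sum u n = (\<Sum>l<n. \<Prod>k<l. u k)"

definition shifted_geom_sum :: "(nat \<Rightarrow> real) \<Rightarrow> nat \<Rightarrow> real" where
  "shifted_geom_sum u p = geom_sum u p + (\<Prod>k<p. u k) - 1"

lemma left_column_less: "i < length ps \<Longrightarrow> left_column ps i < length ps"
  and right_column_less: "i < length ps \<Longrightarrow> right_column ps i < length ps"
  and right_left_column: "i < length ps \<Longrightarrow> right_column ps (left_column ps i) = i"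
  by (auto simp: left_column_def right_column_def)

lemma crossings_pretzel: "(i, j) \<in> crossings (pretzel ps) \<longleftrightarrow> i < length ps \<and> j < ps ! i"
  by (simp add: pretzel_def)

lemma alternating_pretzel:
  assumes "\<forall>p \<in> set ps. 0 < p"
  shows "alternating (pretzel ps)"
proof -
  have "is_over (snd (pretzel_glue ps ((i, j), s))) \<longleftrightarrow> \<not> is_over s" for i j s
    by (cases s) (auto simp: is_over_def Let_def)
  then show ?thesis
    using is_diagram_pretzel[OF assms] by (auto simp: alternating_def pretzel_def)
qed

lemma over_crossing_pretzel:
  "over_crossing (pretzel ps) ((i, j), UL) =
    (if j + 1 < ps ! i then (i, j + 1) else (left_column ps i, ps ! left_column ps i - 1))"
  "over_crossing (pretzel ps) ((i, j), LR) =
    (if 0 < j then (i, j - 1) else (right_column ps i, 0))"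
  by (simp_all add: over_crossing_def is_over_def pretzel_def left_column_def right_column_def Let_def)

lemma is_colouring_pretzel:
  assumes t: "t \<noteq> 0"
  shows "is_colouring (pretzel ps) \<omega> t x \<longleftrightarrow> (\<forall>i<length ps. \<forall>j<ps ! i.
    x (over_crossing (pretzel ps) ((i, j), UL)) - x (i, j) =
      crossing_ratio \<omega> t i j * (x (i, j) - x (over_crossing (pretzel ps) ((i, j), LR))))"
proof -
  have "(1 - t) * a - (if o' then b else c) + t * (if o' then c else b) = 0 \<longleftrightarrow>
      b - a = (if o' then - t else - (1 / t)) * (a - c)" for a b c :: real and o'
    using t by (auto simp: field_simps)
  from this[of "x (i, j)" "\<omega> ((i, j), UR)" "x (over_crossing (pretzel ps) ((i, j), UL))"
      "x (over_crossing (pretzel ps) ((i, j), LR))" for i j]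
  show ?thesis
    unfolding is_colouring_def crossing_ratio_def
    by (auto simp: crossings_pretzel Ball_def if_distrib[of x] if_distrib[of "over_crossing _"]
        if_distrib[of "Pair _"] cong: if_cong)
qed

context
  fixes ps :: "nat list" and \<omega> :: "(nat \<times> nat) strand_end \<Rightarrow> bool" and t :: real
  assumes pos: "\<forall>p \<in> set ps. 0 < p" and t: "t \<noteq> 0"
begin

abbreviation "ratio \<equiv> crossing_ratio \<omega> t"
abbreviation "\<sigma> i \<equiv> geom_sum (ratio i) (ps ! i)"
abbreviation "\<tau> i \<equiv> shifted_geom_sum (ratio i) (ps ! i)"

lemma pos': "i < length ps \<Longrightarrow> 0 < ps ! i"
  using pos by simp

lemma colouring_column:
  assumes x: "is_colouring (pretzel ps) \<omega> t x" and i: "i < length ps"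
    and d: "d = x (i, 0) - x (right_column ps i, 0)"
  shows "j < ps ! i \<Longrightarrow> x (i, j) - x (over_crossing (pretzel ps) ((i, j), LR)) =
      d * (\<Prod>k<j. ratio i k) \<and>
    x (i, j) = x (right_column ps i, 0) + d * geom_sum (ratio i) (j + 1)"
proof (induction j)
  case 0
  then show ?case using d by (simp add: over_crossing_pretzel geom_sum_def)
next
  case (Suc j)
  have "x (over_crossing (pretzel ps) ((i, j), UL)) - x (i, j) =
      ratio i j * (x (i, j) - x (over_crossing (pretzel ps) ((i, j), LR)))"
    using x i Suc.prems unfolding is_colouring_pretzel[OF t] by simp
  moreover have "over_crossing (pretzel ps) ((i, j), UL) = (i, Suc j)"
    "over_crossing (pretzel ps) ((i, Suc j), LR) = (i, j)"
    using Suc.prems by (simp_all add: over_crossing_pretzel)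
  ultimately have step: "x (i, Suc j) - x (i, j) = ratio i j * (d * (\<Prod>k<j. ratio i k))"
    and dn: "over_crossing (pretzel ps) ((i, Suc j), LR) = (i, j)"
    using Suc by simp_all
  from step have "x (i, Suc j) - x (i, j) = d * (\<Prod>k<Suc j. ratio i k)" by simp
  moreover have "x (i, j) = x (right_column ps i, 0) + d * geom_sum (ratio i) (j + 1)"
    using Suc by simp
  moreover have "geom_sum (ratio i) (Suc j + 1) = geom_sum (ratio i) (j + 1) + (\<Prod>k<Suc j. ratio i k)"
    by (simp add: geom_sum_def)
  ultimately show ?case unfolding dn by (simp only: distrib_left) simp
qed

text \<open>
  The colour rises by \<open>\<sigma> (i - 1) * d (i - 1)\<close> and by \<open>\<tau> i * d i\<close> between the same two crossings, the lowest
  one of column \<open>i\<close> and the topmost one of the column to its left: that is what the relation at the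
  topmost crossing of column \<open>i\<close> says.  Once around all columns the differences \<open>d i\<close> add up to zero.
\<close>

lemma colouring_imp_column_differences:
  assumes x: "is_colouring (pretzel ps) \<omega> t x"
  defines "d \<equiv> \<lambda>i. x (i, 0) - x (right_column ps i, 0)"
  shows "i < length ps \<Longrightarrow> \<sigma> (left_column ps i) * d (left_column ps i) = \<tau> i * d i"
    and "(\<Sum>i<length ps. d i) = 0"
proof -
  have top: "x (i, ps ! i - 1) = x (right_column ps i, 0) + d i * \<sigma> i" if "i < length ps" for i
    using colouring_column[OF x that, of "d i" "ps ! i - 1"] pos'[OF that] by (simp add: d_def)
  show "\<sigma> (left_column ps i) * d (left_column ps i) = \<tau> i * d i" if i: "i < length ps"
  proof -
    let ?j = "ps ! i - 1" and ?l = "left_column ps i"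
    have j: "?j < ps ! i" "\<not> ?j + 1 < ps ! i" using pos'[OF i] by auto
    have "x (over_crossing (pretzel ps) ((i, ?j), UL)) - x (i, ?j) =
        ratio i ?j * (x (i, ?j) - x (over_crossing (pretzel ps) ((i, ?j), LR)))"
      using x i j unfolding is_colouring_pretzel[OF t] by blast
    also have "\<dots> = d i * (ratio i ?j * (\<Prod>k<?j. ratio i k))"
      using colouring_column[OF x i, of "d i" ?j] j by (simp add: d_def)
    also have "ratio i ?j * (\<Prod>k<?j. ratio i k) = (\<Prod>k<Suc ?j. ratio i k)" by simp
    also have "Suc ?j = ps ! i" using j by simp
    also have "over_crossing (pretzel ps) ((i, ?j), UL) = (?l, ps ! ?l - 1)"
      using j by (simp add: over_crossing_pretzel)
    also have "x (?l, ps ! ?l - 1) = x (i, 0) + d ?l * \<sigma> ?l"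
      using top[OF left_column_less[OF i]] right_left_column[OF i] by simp
    finally have "x (i, 0) + d ?l * \<sigma> ?l - (x (right_column ps i, 0) + d i * \<sigma> i) =
        d i * (\<Prod>k<ps ! i. ratio i k)"
      using top[OF i] by simp
    moreover have "x (i, 0) = x (right_column ps i, 0) + d i" by (simp add: d_def)
    ultimately show ?thesis by (simp add: shifted_geom_sum_def algebra_simps)
  qed
  show "(\<Sum>i<length ps. d i) = 0"
  proof (cases "length ps")
    case (Suc n)
    have "(\<Sum>i<n. d i) = (\<Sum>i<n. x (i, 0) - x (Suc i, 0))"
      using Suc by (intro sum.cong) (simp_all add: d_def right_column_def)
    then show ?thesis
      using Suc sum_lessThan_telescope'[of "\<lambda>i. x (i, 0)" n]
      by (simp add: d_def right_column_def)
  qed simp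
qed

text \<open>
  The colours are normalised so that the lowest crossing of the leftmost column has colour \<open>0\<close>.
\<close>

lemma column_differences_imp_colouring:
  assumes rel: "\<And>i. i < length ps \<Longrightarrow> \<sigma> (left_column ps i) * d (left_column ps i) = \<tau> i * d i"
    and sum: "(\<Sum>i<length ps. d i) = 0"
  defines "x \<equiv> \<lambda>(i, j). (\<Sum>k \<in> {Suc i..<length ps}. d k) + d i * geom_sum (ratio i) (j + 1)"
  shows "is_colouring (pretzel ps) \<omega> t x"
    and "i < length ps \<Longrightarrow> x (i, 0) - x (right_column ps i, 0) = d i"
proof -
  define B where "B = (\<lambda>i. \<Sum>k \<in> {Suc i..<length ps}. d k)"
  have x: "x (i, j) = B i + d i * geom_sum (ratio i) (j + 1)" for i j
    by (simp add: x_def B_def)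
  have x0: "x (i, 0) = B i + d i" for i by (simp add: x geom_sum_def)
  have B: "x (right_column ps i, 0) = B i" if i: "i < length ps" for i
  proof (cases "Suc i = length ps")
    case True
    then have "{..<length ps} = insert 0 {Suc 0..<length ps}" by auto
    then have "d 0 + B 0 = 0" using sum by (simp add: B_def)
    then show ?thesis using True by (simp add: x0 right_column_def B_def)
  next
    case False
    then have "{Suc i..<length ps} = insert (Suc i) {Suc (Suc i)..<length ps}" using i by auto
    then show ?thesis using False by (simp add: x0 right_column_def B_def)
  qed
  show "x (i, 0) - x (right_column ps i, 0) = d i" if "i < length ps"
    using B[OF that] x0[of i] by simp
  show "is_colouring (pretzel ps) \<omega> t x"
    unfolding is_colouring_pretzel[OF t]
  proof (intro allI impI)
    fix i j assume i: "i < length ps" and j: "j < ps ! i"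
    have dn: "x (i, j) - x (over_crossing (pretzel ps) ((i, j), LR)) = d i * (\<Prod>k<j. ratio i k)"
    proof (cases j)
      case 0
      then show ?thesis using B[OF i] by (simp add: over_crossing_pretzel x geom_sum_def)
    next
      case (Suc j')
      then show ?thesis by (simp add: over_crossing_pretzel x geom_sum_def algebra_simps)
    qed
    have up: "x (over_crossing (pretzel ps) ((i, j), UL)) - x (i, j) =
        d i * (\<Prod>k<Suc j. ratio i k)"
    proof (cases "Suc j < ps ! i")
      case True
      then show ?thesis by (simp add: over_crossing_pretzel x geom_sum_def algebra_simps)
    next
      case False
      let ?l = "left_column ps i"
      have l: "?l < length ps" using i by (rule left_column_less)
      have p: "ps ! i = Suc j" using False j by simp
      have "x (over_crossing (pretzel ps) ((i, j), UL)) = B ?l + d ?l * \<sigma> ?l"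
        using False pos'[OF l] by (simp add: over_crossing_pretzel x)
      also have "B ?l = B i + d i" using B[OF l] right_left_column[OF i] x0 by simp
      finally show ?thesis
        using rel[OF i] p by (simp add: x shifted_geom_sum_def algebra_simps)
    qed
    show "x (over_crossing (pretzel ps) ((i, j), UL)) - x (i, j) =
        ratio i j * (x (i, j) - x (over_crossing (pretzel ps) ((i, j), LR)))"
      unfolding up dn by simp
  qed
qed

text \<open>
  The relations between neighbouring columns determine the differences \<open>d\<close> up to a common factor, so
  that a non-constant colouring exists if and only if any one solution \<open>e\<close> of them has sum zero.
\<close>

theorem pretzel_root_iff:
  assumes ne: "ps \<noteq> []"
    and rel: "\<And>i. i < length ps \<Longrightarrow> \<sigma> (left_column ps i) * e (left_column ps i) = \<tau> i * e i"
    and \<tau>: "\<And>i. i < length ps \<Longrightarrow> \<tau> i \<noteq> 0"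
    and e0: "e 0 \<noteq> 0"
  shows "eval_real t (alexander_polynomial (pretzel ps) \<omega>) = 0 \<longleftrightarrow> (\<Sum>i<length ps. e i) = 0"
proof
  assume sum: "(\<Sum>i<length ps. e i) = 0"
  obtain x where x: "is_colouring (pretzel ps) \<omega> t x"
    "x (0, 0) - x (right_column ps 0, 0) = e 0"
    using column_differences_imp_colouring[OF rel sum] ne by blast
  have "(i, 0) \<in> crossings (pretzel ps)" if "i < length ps" for i
    using pos'[OF that] that by (simp add: crossings_pretzel)
  then show "eval_real t (alexander_polynomial (pretzel ps) \<omega>) = 0"
    using x e0 ne right_column_less[of 0 ps]
    by (intro eval_alexander_polynomial_eq_0[OF alternating_pretzel[OF pos] x(1),
          of "(0, 0)" "(right_column ps 0, 0)"]) auto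
next
  assume zero: "eval_real t (alexander_polynomial (pretzel ps) \<omega>) = 0"
  show "(\<Sum>i<length ps. e i) = 0"
  proof (rule ccontr)
    assume sum: "(\<Sum>i<length ps. e i) \<noteq> 0"
    have const: "x a = x (0, 0)" if x: "is_colouring (pretzel ps) \<omega> t x"
      and a: "a \<in> crossings (pretzel ps)" for x a
    proof -
      define d where "d = (\<lambda>i. x (i, 0) - x (right_column ps i, 0))"
      have d: "i < length ps \<Longrightarrow> \<sigma> (left_column ps i) * d (left_column ps i) = \<tau> i * d i"
        "(\<Sum>i<length ps. d i) = 0" for i
        unfolding d_def using colouring_imp_column_differences[OF x] by blast+
      have ratio_d: "i < length ps \<Longrightarrow> d i * e 0 = d 0 * e i" for i
      proof (induction i)
        case (Suc i)
        have l: "left_column ps (Suc i) = i" by (simp add: left_column_def)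
        have "\<tau> (Suc i) * (d (Suc i) * e 0) = \<sigma> i * (d i * e 0)"
          using d(1)[OF Suc.prems] by (simp add: l)
        also have "\<dots> = d 0 * (\<sigma> i * e i)" using Suc by simp
        also have "\<dots> = \<tau> (Suc i) * (d 0 * e (Suc i))"
          using rel[OF Suc.prems] by (simp add: l)
        finally show ?case using \<tau>[OF Suc.prems] by simp
      qed simp
      have "0 = (\<Sum>i<length ps. d i * e 0)"
        using d(2) by (simp add: sum_distrib_right[symmetric])
      also have "\<dots> = d 0 * (\<Sum>i<length ps. e i)"
        using ratio_d by (simp add: sum_distrib_left)
      finally have "d 0 = 0" using sum by simp
      then have d0: "d i = 0" if "i < length ps" for i using ratio_d[OF that] e0 by simp
      have base: "i < length ps \<Longrightarrow> x (i, 0) = x (0, 0)" for i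
      proof (induction i)
        case (Suc i)
        then show ?case using d0[of i] by (simp add: d_def right_column_def)
      qed simp
      obtain i j where a': "a = (i, j)" "i < length ps" "j < ps ! i"
        using a crossings_pretzel by (cases a) auto
      then have "x a = x (right_column ps i, 0)"
        using colouring_column[OF x a'(2), of "d i" j] d0 by (simp add: d_def)
      then show ?thesis using base[OF right_column_less[OF a'(2)]] by simp
    qed
    have "eval_real t (alexander_polynomial (pretzel ps) \<omega>) \<noteq> 0"
    proof (rule eval_alexander_polynomial_neq_0[OF alternating_pretzel[OF pos]])
      have "(0, 0) \<in> crossings (pretzel ps)" using ne pos by (simp add: crossings_pretzel)
      then show "crossings (pretzel ps) \<noteq> {}" by blast
      show "x a = x b" if "is_colouring (pretzel ps) \<omega> t x"
        "a \<in> crossings (pretzel ps)" "b \<in> crossings (pretzel ps)" for x a b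
        using const[OF that(1,2)] const[OF that(1,3)] by simp
    qed
    then show False using zero by simp
  qed
qed

end


section \<open>Pretzel knots with one even column\<close>

lemma geom_sum_cong: "(\<And>j. j < n \<Longrightarrow> u j = v j) \<Longrightarrow> geom_sum u n = geom_sum v n"
  unfolding geom_sum_def by (intro sum.cong prod.cong) auto

lemma shifted_geom_sum_cong: "(\<And>j. j < n \<Longrightarrow> u j = v j) \<Longrightarrow> shifted_geom_sum u n = shifted_geom_sum v n"
  unfolding shifted_geom_sum_def using geom_sum_cong[of n u v] by simp

lemma geom_sum_const:
  assumes "s \<noteq> 1"
  shows "geom_sum (\<lambda>_. s) n = (1 - s ^ n) / (1 - s)"
    and "shifted_geom_sum (\<lambda>_. s) n = s * geom_sum (\<lambda>_. s) n"
proof -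
  show *: "geom_sum (\<lambda>_. s) n = (1 - s ^ n) / (1 - s)"
    using assms geometric_sum[of s n] by (simp add: geom_sum_def field_simps)
  show "shifted_geom_sum (\<lambda>_. s) n = s * geom_sum (\<lambda>_. s) n"
    using assms unfolding shifted_geom_sum_def * by (simp add: field_simps)
qed

lemma geom_sum_alternating:
  assumes "s \<noteq> 0"
  shows "geom_sum (\<lambda>j. if even j then s else 1 / s) (2 * m) = of_nat m * (1 + s)"
    and "shifted_geom_sum (\<lambda>j. if even j then s else 1 / s) (2 * m) = of_nat m * (1 + s)"
proof -
  have prod: "(\<Prod>j<2 * m. if even j then s else 1 / s) = 1" for m :: nat
    by (induction m) (use assms in simp_all)
  show *: "geom_sum (\<lambda>j. if even j then s else 1 / s) (2 * m) = of_nat m * (1 + s)"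
    unfolding geom_sum_def by (induction m; simp add: prod; simp add: algebra_simps)
  show "shifted_geom_sum (\<lambda>j. if even j then s else 1 / s) (2 * m) = of_nat m * (1 + s)"
    unfolding shifted_geom_sum_def * by (simp add: prod)
qed

text \<open>
  Going up one crossing exchanges the two strands of a column, whereas an arc joining two columns
  reverses the vertical direction.
\<close>

lemma pretzel_orientation:
  assumes pos: "\<forall>p \<in> set ps. 0 < p" and \<omega>: "is_orientation (pretzel ps) \<omega>" and i: "i < length ps"
  shows pretzel_orientation_column: "j < ps ! i \<Longrightarrow>
      \<omega> ((i, j), UR) = (if even j then \<omega> ((i, 0), UR) else \<omega> ((i, 0), UL)) \<and>
      \<omega> ((i, j), UL) = (if even j then \<omega> ((i, 0), UL) else \<omega> ((i, 0), UR))"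
    and pretzel_orientation_bottom: "\<omega> ((right_column ps i, 0), UR) = (\<not> \<omega> ((i, 0), UL))"
    and pretzel_orientation_top:
      "\<omega> ((right_column ps i, ps ! right_column ps i - 1), UL) = (\<not> \<omega> ((i, ps ! i - 1), UR))"
proof -
  have glue: "\<omega> (pretzel_glue ps ((i, j), s)) = (\<not> \<omega> ((i, j), s))"
    if "i < length ps" "j < ps ! i" for i j s
    using \<omega> that by (auto simp: is_orientation_def strand_ends_def pretzel_def)
  have opp: "\<omega> ((i, j), LL) = (\<not> \<omega> ((i, j), UR))" "\<omega> ((i, j), LR) = (\<not> \<omega> ((i, j), UL))"
    if "i < length ps" "j < ps ! i" for i j
  proof -
    have c: "(i, j) \<in> crossings (pretzel ps)" using that by (simp add: crossings_pretzel)
    have "\<omega> ((i, j), opposite s) = (\<not> \<omega> ((i, j), s))" for s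
      using \<omega> c by (auto simp: is_orientation_def)
    from this[of UR] this[of UL] show "\<omega> ((i, j), LL) = (\<not> \<omega> ((i, j), UR))"
      "\<omega> ((i, j), LR) = (\<not> \<omega> ((i, j), UL))" by simp_all
  qed
  have p: "0 < ps ! k" if "k < length ps" for k using pos that by simp
  have r: "right_column ps i < length ps" using i by (rule right_column_less)
  show "j < ps ! i \<Longrightarrow>
      \<omega> ((i, j), UR) = (if even j then \<omega> ((i, 0), UR) else \<omega> ((i, 0), UL)) \<and>
      \<omega> ((i, j), UL) = (if even j then \<omega> ((i, 0), UL) else \<omega> ((i, 0), UR))"
  proof (induction j)
    case (Suc j)
    have "\<omega> ((i, Suc j), UR) = \<omega> ((i, j), UL)" "\<omega> ((i, Suc j), UL) = \<omega> ((i, j), UR)"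
      using glue[OF i, of j UL] glue[OF i, of j UR] opp[OF i, of "Suc j"] Suc.prems
      by (simp_all add: Let_def)
    then show ?case using Suc by auto
  qed simp
  show "\<omega> ((right_column ps i, 0), UR) = (\<not> \<omega> ((i, 0), UL))"
    using glue[OF i p[OF i], of LR] opp[OF i p[OF i]] opp[OF r p[OF r]]
    by (auto simp: Let_def right_column_def split: if_splits)
  show "\<omega> ((right_column ps i, ps ! right_column ps i - 1), UL) = (\<not> \<omega> ((i, ps ! i - 1), UR))"
    using glue[OF i, of "ps ! i - 1" UR] p[OF i]
    by (auto simp: Let_def right_column_def split: if_splits)
qed

text \<open>
  For odd \<open>p\<close> this is \<open>z * F (p - 1) / F p\<close> with the Fibonacci polynomials
  \<open>F 0 = 0\<close>, \<open>F 1 = 1\<close>, \<open>F (p + 1) = z * F p + F (p - 1)\<close> at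
  \<open>z\<^sup>2 = (1 - t)\<^sup>2 / t\<close>; these are the Conway polynomials of the torus links \<open>T(2, p)\<close>.
\<close>

definition rho :: "nat \<Rightarrow> real \<Rightarrow> real" where
  "rho p t = (1 - t) * (1 - t ^ (p - 1)) / (1 + t ^ p)"

definition pretzel_equation :: "nat \<Rightarrow> nat \<Rightarrow> nat \<Rightarrow> nat \<Rightarrow> real \<Rightarrow> real" where
  "pretzel_equation b m p q t =
    of_nat m * ((of_nat b + 1) * ((1 - t)\<^sup>2 / t) + rho p t + rho q t)"

text \<open>
  Reversing the orientation of a knot replaces \<open>t\<close> by \<open>1 / t\<close> in its colouring relations, so the
  equation for the roots has to be invariant under this substitution.
\<close>

lemma rho_inverse:
  assumes "t > 0" "p > 0"
  shows "rho p (1 / t) = rho p t"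
proof -
  obtain n where p: "p = Suc n" using assms gr0_implies_Suc by blast
  have "t ^ n > 0" "1 + t * t ^ n > 0" using assms by (simp_all add: add_pos_pos)
  then show ?thesis
    using assms by (simp add: rho_def p power_one_over divide_simps) (simp add: algebra_simps)
qed

lemma pretzel_equation_inverse:
  assumes "t > 0" "p > 0" "q > 0"
  shows "pretzel_equation b m p q (1 / t) = pretzel_equation b m p q t"
proof -
  have "(1 - 1 / t)\<^sup>2 / (1 / t) = (1 - t)\<^sup>2 / t"
    using assms by (simp add: field_simps power2_eq_square)
  then show ?thesis using assms by (simp add: pretzel_equation_def rho_inverse)
qed

context
  fixes b m p q :: nat and \<omega> :: "(nat \<times> nat) strand_end \<Rightarrow> bool" and ps
  assumes m: "m > 0" and p: "odd p" and q: "odd q"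
    and \<omega>: "is_orientation (pretzel ps) \<omega>"
    and ps_def: "ps = replicate (2 * b) 1 @ [2 * m, p, q]"
begin

lemma ps_nth: "length ps = 2 * b + 3" "i < 2 * b \<Longrightarrow> ps ! i = 1"
    "ps ! (2 * b) = 2 * m" "ps ! Suc (2 * b) = p" "ps ! Suc (Suc (2 * b)) = q"
  by (auto simp: ps_def nth_append)

lemma ps_pos: "\<forall>p \<in> set ps. 0 < p"
  using m p q by (auto simp: ps_def odd_pos)

text \<open>
  The orientation is determined by the direction of a single strand.  In the columns with an odd number
  of crossings both strands run in parallel, alternately up and down from column to column; in the
  column with an even number of crossings they run in opposite directions, so that there the
  over-strands alternate.
\<close>

lemma pretzel_ratio:
  assumes t: "t > 0"
  defines "u \<equiv> (if \<omega> ((2 * b + 1, 0), UR) then t else 1 / t)"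
  shows "i < 2 * b \<Longrightarrow> crossing_ratio \<omega> t i 0 = (if even i then - u else - (1 / u))"
    and "j < 2 * m \<Longrightarrow> crossing_ratio \<omega> t (2 * b) j = (if even j then - u else - (1 / u))"
    and "j < p \<Longrightarrow> crossing_ratio \<omega> t (Suc (2 * b)) j = - u"
    and "j < q \<Longrightarrow> crossing_ratio \<omega> t (Suc (Suc (2 * b))) j = - (1 / u)"
proof -
  define P where "P = (\<lambda>i. \<omega> ((i, 0), UR))"
  define Q where "Q = (\<lambda>i. \<omega> ((i, 0), UL))"
  have col: "\<omega> ((i, j), UR) = (if even j then P i else Q i)"
    "\<omega> ((i, j), UL) = (if even j then Q i else P i)" if "i < length ps" "j < ps ! i" for i j
    using pretzel_orientation_column[OF ps_pos \<omega> that] by (simp_all add: P_def Q_def)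
  have bottom: "P (right_column ps i) = (\<not> Q i)" if "i < length ps" for i
    using pretzel_orientation_bottom[OF ps_pos \<omega> that] by (simp add: P_def Q_def)
  have last: "\<omega> ((i, ps ! i - 1), UR) = (if odd (ps ! i) then P i else Q i)"
    "\<omega> ((i, ps ! i - 1), UL) = (if odd (ps ! i) then Q i else P i)" if "i < length ps" for i
  proof -
    have "0 < ps ! i" using ps_pos that by simp
    then show "\<omega> ((i, ps ! i - 1), UR) = (if odd (ps ! i) then P i else Q i)"
      "\<omega> ((i, ps ! i - 1), UL) = (if odd (ps ! i) then Q i else P i)"
      using col[OF that, of "ps ! i - 1"] by auto
  qed
  have top: "(if odd (ps ! right_column ps i) then Q (right_column ps i) else P (right_column ps i)) =
      (\<not> (if odd (ps ! i) then P i else Q i))" if "i < length ps" for i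
    using pretzel_orientation_top[OF ps_pos \<omega> that] last(1)[OF that]
      last(2)[OF right_column_less[OF that]] by simp
  define o' where "o' = P (Suc (2 * b))"
  have right: "right_column ps (2 * b) = Suc (2 * b)"
    "right_column ps (Suc (2 * b)) = Suc (Suc (2 * b))"
    "right_column ps (Suc (Suc (2 * b))) = 0"
    "i < 2 * b \<Longrightarrow> right_column ps i = Suc i" for i
    by (simp_all add: right_column_def ps_nth)
  have QB: "Q (Suc (2 * b)) = o'" and QA: "Q (2 * b) = (\<not> o')"
    using bottom[of "2 * b"] top[of "2 * b"] p by (auto simp: right ps_nth o'_def)
  have PC: "P (Suc (Suc (2 * b))) = (\<not> o')" and QC: "Q (Suc (Suc (2 * b))) = (\<not> o')"
    using bottom[of "Suc (2 * b)"] top[of "Suc (2 * b)"] p q QB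
    by (auto simp: right ps_nth o'_def)
  have ones: "i < 2 * b \<Longrightarrow> P i = (o' = even i) \<and> Q i = (o' = even i)" for i
  proof (induction i)
    case 0
    then show ?case
      using bottom[of "Suc (Suc (2 * b))"] top[of "Suc (Suc (2 * b))"] q PC QC
      by (auto simp: right ps_nth)
  next
    case (Suc i)
    then show ?case
      using bottom[of i] top[of i] by (auto simp: right ps_nth)
  qed
  have PA: "P (2 * b) = o'"
  proof (cases "b = 0")
    case True
    have "P 0 = o'" using bottom[of "Suc (Suc (2 * b))"] QC unfolding right by (simp add: ps_nth)
    then show ?thesis using True by simp
  next
    case False
    then show ?thesis
      using bottom[of "2 * b - 1"] right(4)[of "2 * b - 1"] ones[of "2 * b - 1"]
      by (auto simp: ps_nth)
  qed
  have neg: "crossing_ratio \<omega> t i j = (if \<omega> ((i, j), UR) = o' then - u else - (1 / u))" for i j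
    using t by (auto simp: crossing_ratio_def u_def o'_def P_def)
  show "crossing_ratio \<omega> t i 0 = (if even i then - u else - (1 / u))" if "i < 2 * b"
    unfolding neg using ones[OF that] by (auto simp: P_def)
  show "crossing_ratio \<omega> t (2 * b) j = (if even j then - u else - (1 / u))" if "j < 2 * m"
    unfolding neg using col[of "2 * b" j] that PA QA by (auto simp: ps_nth)
  show "crossing_ratio \<omega> t (Suc (2 * b)) j = - u" if "j < p"
    unfolding neg using col[of "Suc (2 * b)" j] that QB by (auto simp: ps_nth o'_def)
  show "crossing_ratio \<omega> t (Suc (Suc (2 * b))) j = - (1 / u)" if "j < q"
    unfolding neg using col[of "Suc (Suc (2 * b))" j] that PC QC by (auto simp: ps_nth)
qed

text \<open>
  Here the relations between neighbouring columns can be solved explicitly: the number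
  \<open>\<tau> i * e i\<close> alternates between \<open>s\<close> and \<open>1\<close>, except that it does not change across the even
  column, for which the two geometric sums agree.  Up to the factor \<open>s / A\<close> the sum of the solution is
  \<open>1 - pretzel_equation b m p q u\<close>.
\<close>

theorem pretzel_root_iff_equation:
  assumes t: "t > 0" "t \<noteq> 1"
  shows "eval_real t (alexander_polynomial (pretzel ps) \<omega>) = 0 \<longleftrightarrow> pretzel_equation b m p q t = 1"
proof -
  define u where "u = (if \<omega> ((2 * b + 1, 0), UR) then t else 1 / t)"
  note ratio = pretzel_ratio[OF t(1), folded u_def]
  have u: "u > 0" "u \<noteq> 1" using t by (auto simp: u_def)
  define s where "s = - u"
  have s: "s < 0" "s \<noteq> 0" "s \<noteq> 1" "1 / s \<noteq> 1" "1 + s \<noteq> 0" "- (1 / u) = 1 / s" "u = - s"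
    using u by (auto simp: s_def field_simps)
  define \<sigma> where "\<sigma> = (\<lambda>i. geom_sum (crossing_ratio \<omega> t i) (ps ! i))"
  define \<tau> where "\<tau> = (\<lambda>i. shifted_geom_sum (crossing_ratio \<omega> t i) (ps ! i))"
  \<comment> \<open>The values of \<open>\<sigma>\<close> on the even column and on the two odd columns to its right.\<close>
  define A where "A = of_nat m * (1 + s)"
  define B where "B = (1 + u ^ p) / (1 + u)"
  define C where "C = (1 + (1 / u) ^ q) / (1 + 1 / u)"
  have ones: "\<sigma> i = 1" "\<tau> i = (if even i then s else 1 / s)" if "i < 2 * b" for i
    using ratio(1)[OF that] that s
    by (simp_all add: \<sigma>_def \<tau>_def ps_nth geom_sum_def shifted_geom_sum_def)
  have "\<sigma> (2 * b) = geom_sum (\<lambda>j. if even j then s else 1 / s) (2 * m)"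
    "\<tau> (2 * b) = shifted_geom_sum (\<lambda>j. if even j then s else 1 / s) (2 * m)"
    unfolding \<sigma>_def \<tau>_def ps_nth
    by (intro geom_sum_cong shifted_geom_sum_cong; use ratio(2) s in simp)+
  then have colA: "\<sigma> (2 * b) = A" "\<tau> (2 * b) = A"
    using geom_sum_alternating[OF s(2)] by (simp_all add: A_def)
  have "\<sigma> (Suc (2 * b)) = geom_sum (\<lambda>_. s) p" "\<tau> (Suc (2 * b)) = shifted_geom_sum (\<lambda>_. s) p"
    unfolding \<sigma>_def \<tau>_def ps_nth
    by (intro geom_sum_cong shifted_geom_sum_cong; use ratio(3) s in simp)+
  moreover have "geom_sum (\<lambda>_. s) p = B"
    using geom_sum_const(1)[OF s(3)] p by (simp add: B_def s_def)
  ultimately have colB: "\<sigma> (Suc (2 * b)) = B" "\<tau> (Suc (2 * b)) = s * B"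
    using geom_sum_const(2)[OF s(3)] by simp_all
  have "\<sigma> (Suc (Suc (2 * b))) = geom_sum (\<lambda>_. 1 / s) q"
    "\<tau> (Suc (Suc (2 * b))) = shifted_geom_sum (\<lambda>_. 1 / s) q"
    unfolding \<sigma>_def \<tau>_def ps_nth
    by (intro geom_sum_cong shifted_geom_sum_cong; use ratio(4) s in simp)+
  moreover have "geom_sum (\<lambda>_. 1 / s) q = C"
    using geom_sum_const(1)[OF s(4)] q by (simp add: C_def s_def power_minus_odd)
  ultimately have colC: "\<sigma> (Suc (Suc (2 * b))) = C" "\<tau> (Suc (Suc (2 * b))) = 1 / s * C"
    using geom_sum_const(2)[OF s(4)] by simp_all
  have ABC: "A \<noteq> 0" "B \<noteq> 0" "C \<noteq> 0"
  proof -
    show "A \<noteq> 0" using m s by (simp add: A_def)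
    have "B > 0" "C > 0" unfolding B_def C_def using u by (simp_all add: add_pos_pos)
    then show "B \<noteq> 0" "C \<noteq> 0" by simp_all
  qed
  define e where "e = (\<lambda>i. if i < 2 * b then (if even i then 1 else s) else
    if i = 2 * b then s / A else if i = Suc (2 * b) then 1 / B else s / C)"
  have e: "i < 2 * b \<Longrightarrow> e i = (if even i then 1 else s)" "e (2 * b) = s / A"
    "e (Suc (2 * b)) = 1 / B" "e (Suc (Suc (2 * b))) = s / C" for i
    by (simp_all add: e_def)
  have cases: "i < 2 * b \<or> i = 2 * b \<or> i = Suc (2 * b) \<or> i = Suc (Suc (2 * b))"
    if "i < length ps" for i using that by (auto simp: ps_nth)
  have "\<tau> i \<noteq> 0" if "i < length ps" for i
    using cases[OF that] ones colA colB colC ABC s by (auto split: if_splits)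
  moreover have "\<sigma> (left_column ps i) * e (left_column ps i) = \<tau> i * e i" if i: "i < length ps" for i
  proof -
    have out: "\<sigma> j * e j = (if j < 2 * b \<and> even j \<or> j = Suc (2 * b) then 1 else s)"
      if "j < length ps" for j
      using cases[OF that] ones(1)[of j] colA(1) colB(1) colC(1) ABC e by auto
    have "\<tau> i * e i = (if i < 2 * b \<and> odd i \<or> i = Suc (Suc (2 * b)) then 1 else s)"
      using cases[OF i] ones(2)[of i] colA(2) colB(2) colC(2) ABC e s(2) by auto
    moreover have "(left_column ps i < 2 * b \<and> even (left_column ps i) \<or>
        left_column ps i = Suc (2 * b)) \<longleftrightarrow> (i < 2 * b \<and> odd i \<or> i = Suc (Suc (2 * b)))"
    proof (cases i)
      case (Suc i')
      have "(i' < 2 * b \<and> even i' \<or> i' = Suc (2 * b)) \<longleftrightarrow>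
          (Suc i' < 2 * b \<and> odd (Suc i') \<or> Suc i' = Suc (Suc (2 * b)))"
        by presburger
      then show ?thesis using Suc by (simp add: left_column_def)
    qed (simp add: left_column_def ps_nth)
    ultimately show ?thesis using out[OF left_column_less[OF i]] by simp
  qed
  moreover have "e 0 \<noteq> 0"
    using s ABC by (simp add: e_def)
  ultimately have "eval_real t (alexander_polynomial (pretzel ps) \<omega>) = 0 \<longleftrightarrow>
      (\<Sum>i<length ps. e i) = 0"
    using t by (intro pretzel_root_iff[OF ps_pos]) (simp_all add: \<sigma>_def \<tau>_def ps_def)
  also have "(\<Sum>i<length ps. e i) = s / A * (1 - pretzel_equation b m p q u)"
  proof -
    have "(\<Sum>i<2 * b. e i) = (\<Sum>i<2 * b. if even i then 1 else s)"
      by (intro sum.cong) (simp_all add: e)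
    also have "\<dots> = of_nat b * (1 + s)" by (induction b) (simp_all add: algebra_simps)
    finally have sum: "(\<Sum>i<length ps. e i) = of_nat b * (1 + s) + s / A + 1 / B + s / C"
      by (simp add: ps_nth e numeral_3_eq_3)
    have pq: "1 + u ^ p > 0" "1 + u ^ q > 0" using u by (simp_all add: add_pos_pos)
    have up: "u ^ p = u * u ^ (p - 1)" "u ^ q = u * u ^ (q - 1)"
      using odd_pos[OF p] odd_pos[OF q] by (simp_all add: power_eq_if)
    have rp: "(1 - u) * (1 / B) = u * rho p u + (1 - u)"
      using pq u by (simp add: B_def rho_def divide_simps) (simp add: up algebra_simps)
    have "C = (1 + u ^ q) * u / (u ^ q * (1 + u))"
      using u by (simp add: C_def power_one_over divide_simps) (simp add: algebra_simps)
    then have sC: "s / C = - (u ^ q * (1 + u) / (1 + u ^ q))"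
      using u by (simp add: s_def)
    have rq: "(1 - u) * (s / C) = u * rho q u - u * (1 - u)"
      using pq u by (subst sC)
        (simp add: rho_def divide_simps, simp add: up algebra_simps)
    have factor: "M * (1 - u) * (b' * (1 - u)) + s + M * (1 - u) * X + M * (1 - u) * Y =
        M * (b' * (1 - u)\<^sup>2 + (1 - u) * X + (1 - u) * Y) + s" for M b' X Y :: real
      by (simp add: algebra_simps power2_eq_square)
    have "A * (s / A) = s" using ABC by simp
    then have "A * (of_nat b * (1 + s) + s / A + 1 / B + s / C) =
        A * (of_nat b * (1 + s)) + s + A * (1 / B) + A * (s / C)"
      by (simp only: distrib_left)
    also have "1 + s = 1 - u" by (simp add: s_def)
    also have "A * (of_nat b * (1 - u)) + s + A * (1 / B) + A * (s / C) =
        of_nat m * (of_nat b * (1 - u)\<^sup>2 + (1 - u) * (1 / B) + (1 - u) * (s / C)) + s"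
      unfolding A_def \<open>1 + s = 1 - u\<close> by (rule factor)
    also have "\<dots> = s * (1 - pretzel_equation b m p q u)"
      unfolding rp rq pretzel_equation_def using u
      by (simp add: s_def field_simps power2_eq_square)
    finally have "A * (\<Sum>i<length ps. e i) = s * (1 - pretzel_equation b m p q u)"
      unfolding sum \<open>1 + s = 1 - u\<close> .
    then show ?thesis using ABC(1) by (simp add: eq_divide_eq mult.commute)
  qed
  also have "\<dots> = 0 \<longleftrightarrow> pretzel_equation b m p q u = 1"
    using s ABC by auto
  also have "pretzel_equation b m p q u = pretzel_equation b m p q t"
    using pretzel_equation_inverse[OF t(1) odd_pos[OF p] odd_pos[OF q]] by (simp add: u_def)
  finally show ?thesis .
qed

end


section \<open>Separating the two knots\<close>

lemma rho_add_2:
  assumes "t > 0" "p > 0"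
  shows "rho (p + 2) t = ((1 - t)\<^sup>2 / t + rho p t) / (1 + (1 - t)\<^sup>2 / t + rho p t)"
proof -
  obtain n where p: "p = Suc n" using assms(2) gr0_implies_Suc by blast
  define w where "w = t ^ n"
  have w: "w > 0" using assms by (simp add: w_def)
  have pos: "1 + t * w > 0" "1 + t * (t * (t * w)) > 0" using assms w by (simp_all add: add_pos_pos)
  have rho: "rho p t = (1 - t) * (1 - w) / (1 + t * w)"
    "rho (p + 2) t = (1 - t) * (1 - t * (t * w)) / (1 + t * (t * (t * w)))"
    by (simp_all add: rho_def p w_def)
  have num: "(1 - t)\<^sup>2 / t + rho p t = (1 - t) * (1 - t * (t * w)) / (t * (1 + t * w))"
    using assms pos unfolding rho by (simp add: divide_simps) (simp add: algebra_simps power2_eq_square)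
  have "1 + (1 - t)\<^sup>2 / t + rho p t = 1 + ((1 - t)\<^sup>2 / t + rho p t)" by simp
  also have "\<dots> = (1 + t * (t * (t * w))) / (t * (1 + t * w))"
    unfolding num using assms pos by (simp add: divide_simps) (simp add: algebra_simps)
  finally show ?thesis
    unfolding num rho(2) using assms pos by simp
qed

lemma rho_nonneg: "0 < t \<Longrightarrow> t < 1 \<Longrightarrow> 0 \<le> rho p t"
  unfolding rho_def by (intro divide_nonneg_pos mult_nonneg_nonneg) (simp_all add: power_le_one add_pos_pos)

text \<open>
  With \<open>x = (1 - t)\<^sup>2 / t\<close> and the values of \<open>rho\<close> at three consecutive odd numbers, the
  hypothesis is the equation of the second knot and the conclusion compares the left-hand side of the
  first knot with \<open>1\<close>.  By the recursion for \<open>\<gamma>\<close> and \<open>\<epsilon>\<close> the two left-hand sides differ by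
  \<open>\<gamma> * (1 - M * (x + \<alpha>)) + \<epsilon> * (1 - M * (x + \<gamma>))\<close>.  This becomes negative for large \<open>x\<close>, but where the left-hand side of the second knot equals \<open>1\<close> both
  factors \<open>1 - M * \<dots>\<close> are positive.
\<close>

lemma recursion_separates_equations:
  fixes M x \<alpha> \<gamma> \<epsilon> :: real
  assumes pos: "M > 0" "x > 0" "\<alpha> \<ge> 0"
    and \<gamma>: "\<gamma> = (x + \<alpha>) / (1 + x + \<alpha>)" and \<epsilon>: "\<epsilon> = (x + \<gamma>) / (1 + x + \<gamma>)"
    and eq: "M * ((M + 3) * x + \<alpha> + \<gamma>) = 1"
  shows "(M + 1) * (M * x + \<gamma> + \<epsilon>) > 1"
proof -
  have g0: "\<gamma> > 0" unfolding \<gamma> using pos by simp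
  then have e0: "\<epsilon> > 0" unfolding \<epsilon> using pos by simp
  have g: "\<gamma> - \<alpha> = x - \<gamma> * (x + \<alpha>)"
  proof -
    have "\<gamma> * (1 + x + \<alpha>) = x + \<alpha>" unfolding \<gamma> using pos by simp
    then show ?thesis by (simp add: algebra_simps)
  qed
  have e: "\<epsilon> - \<gamma> = x - \<epsilon> * (x + \<gamma>)"
  proof -
    have "\<epsilon> * (1 + x + \<gamma>) = x + \<gamma>" unfolding \<epsilon> using pos g0 by simp
    then show ?thesis by (simp add: algebra_simps)
  qed
  have "M * (M * x) > 0" "M * x > 0" "M * \<alpha> \<ge> 0" "M * \<gamma> > 0" using pos g0 by simp_all
  then have bound: "M * (x + \<alpha>) < 1" "M * (x + \<gamma>) < 1"
    using eq by (simp_all add: algebra_simps)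
  have "(M + 1) * (M * x + \<gamma> + \<epsilon>) - M * ((M + 3) * x + \<alpha> + \<gamma>) =
      \<gamma> + \<epsilon> - 2 * M * x + M * ((\<gamma> - \<alpha>) + (\<epsilon> - \<gamma>))"
    by (simp add: algebra_simps)
  also have "\<dots> = \<gamma> * (1 - M * (x + \<alpha>)) + \<epsilon> * (1 - M * (x + \<gamma>))"
    unfolding g e by (simp add: algebra_simps)
  also have "\<dots> > 0" using g0 e0 bound by (simp add: add_pos_pos)
  finally show ?thesis using eq by simp
qed

lemma pretzel_equation_solvable:
  assumes "m > 0"
  shows "\<exists>t>0. t < 1 \<and> pretzel_equation b m p q t = 1"
proof -
  let ?f = "pretzel_equation b m p q"
  \<comment> \<open>At \<open>t = 1 / 4\<close> the term \<open>(1 - t)\<^sup>2 / t\<close> equals \<open>9 / 4\<close>, which already makes the left-hand side at least \<open>1\<close>.\<close>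
  have "1 \<le> real m * ((real b + 1) * (9 / 4))"
  proof -
    have "1 \<le> real m" "1 \<le> (real b + 1) * (9 / 4)" using assms by simp_all
    then show ?thesis using mult_mono[of 1 "real m" 1 "(real b + 1) * (9 / 4)"] by simp
  qed
  also have "(9 :: real) / 4 = (1 - 1 / 4)\<^sup>2 / (1 / 4)" by (simp add: power2_eq_square)
  also have "real m * ((real b + 1) * ((1 - 1 / 4)\<^sup>2 / (1 / 4))) \<le> ?f (1 / 4)"
  proof -
    have "0 \<le> rho p (1 / 4)" "0 \<le> rho q (1 / 4)" by (rule rho_nonneg; simp)+
    then show ?thesis unfolding pretzel_equation_def by (intro mult_left_mono) linarith+
  qed
  finally have "1 \<le> ?f (1 / 4)" .
  moreover have at_1: "?f 1 = 0" by (simp add: pretzel_equation_def rho_def)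
  moreover have "continuous_on {1 / 4..1} ?f"
  proof -
    have "1 + t ^ n \<noteq> 0" if "t \<in> {1 / 4..1}" for t :: real and n
    proof -
      have "0 \<le> t ^ n" using that by simp
      then show ?thesis by linarith
    qed
    then show ?thesis
      unfolding pretzel_equation_def rho_def by (intro continuous_intros) auto
  qed
  ultimately obtain t where t: "1 / 4 \<le> t" "t \<le> 1" "?f t = 1"
    using IVT2'[of ?f 1 1 "1 / 4"] by auto
  moreover have "t \<noteq> 1" using t(3) at_1 by auto
  ultimately show ?thesis by (intro exI[of _ t]) auto
qed

lemma eq_up_to_units_root:
  assumes "eq_up_to_units f g" "t \<noteq> 0"
  shows "eval_real t f = 0 \<longleftrightarrow> eval_real t g = 0"
proof -
  obtain m n where "monom 1 m * f = monom 1 n * g \<or> monom 1 m * f = - (monom 1 n * g)"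
    using assms(1) by (auto simp: eq_up_to_units_def)
  then have "t ^ m * eval_real t f = t ^ n * eval_real t g \<or>
      t ^ m * eval_real t f = - (t ^ n * eval_real t g)"
    by (metis eval_real_mult eval_real_uminus eval_real_monom)
  then show ?thesis using assms(2) by auto
qed

text \<open>
  Writing \<open>k = 2 * h\<close>, the second knot provides the root and \<open>recursion_separates_equations\<close> is applied
  with \<open>M = h + 1\<close>.
\<close>

theorem proposition1p3:
  fixes k :: nat
    and \<omega>\<^sub>1 \<omega>\<^sub>2 :: "(nat \<times> nat) strand_end \<Rightarrow> bool"
  assumes "even k"
    and "is_orientation (pretzel_ones k [k + 4, k + 3, k + 5]) \<omega>\<^sub>1"
    and "is_orientation (pretzel_ones (k + 6) [k + 2, k + 1, k + 3]) \<omega>\<^sub>2"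
  shows "\<not> eq_up_to_units
    (alexander_polynomial (pretzel_ones k [k + 4, k + 3, k + 5]) \<omega>\<^sub>1)
    (alexander_polynomial (pretzel_ones (k + 6) [k + 2, k + 1, k + 3]) \<omega>\<^sub>2)"
proof
  assume eq: "eq_up_to_units
    (alexander_polynomial (pretzel_ones k [k + 4, k + 3, k + 5]) \<omega>\<^sub>1)
    (alexander_polynomial (pretzel_ones (k + 6) [k + 2, k + 1, k + 3]) \<omega>\<^sub>2)"
  obtain h where k: "k = 2 * h" using assms(1) by (rule evenE)
  obtain t where t: "t > 0" "t < 1" and
    root: "pretzel_equation (h + 3) (h + 1) (2 * h + 1) (2 * h + 3) t = 1"
    using pretzel_equation_solvable[of "h + 1" "h + 3"] by auto
  have ps\<^sub>1: "replicate k 1 @ [k + 4, k + 3, k + 5] =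
      replicate (2 * h) 1 @ [2 * (h + 2), 2 * h + 3, 2 * h + 5]"
    by (simp add: k)
  have ps\<^sub>2: "replicate (k + 6) 1 @ [k + 2, k + 1, k + 3] =
      replicate (2 * (h + 3)) 1 @ [2 * (h + 1), 2 * h + 1, 2 * h + 3]"
    by (simp add: k)
  have "eval_real t (alexander_polynomial (pretzel_ones (k + 6) [k + 2, k + 1, k + 3]) \<omega>\<^sub>2) = 0"
    using pretzel_root_iff_equation[OF _ _ _ assms(3)[unfolded pretzel_ones_def] ps\<^sub>2, of t] root t
    by (simp add: pretzel_ones_def)
  then have "eval_real t (alexander_polynomial (pretzel_ones k [k + 4, k + 3, k + 5]) \<omega>\<^sub>1) = 0"
    using eq_up_to_units_root[OF eq, of t] t by simp
  then have "pretzel_equation h (h + 2) (2 * h + 3) (2 * h + 5) t = 1"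
    using pretzel_root_iff_equation[OF _ _ _ assms(2)[unfolded pretzel_ones_def] ps\<^sub>1, of t] t
    by (simp add: pretzel_ones_def)
  moreover have "pretzel_equation h (h + 2) (2 * h + 3) (2 * h + 5) t > 1"
  proof -
    let ?x = "(1 - t)\<^sup>2 / t" and ?\<rho> = "\<lambda>i. rho (2 * h + i) t"
    have "(real h + 1 + 1) * ((real h + 1) * ?x + ?\<rho> 3 + ?\<rho> 5) > 1"
    proof (rule recursion_separates_equations)
      show "?\<rho> 3 = (?x + ?\<rho> 1) / (1 + ?x + ?\<rho> 1)" "?\<rho> 5 = (?x + ?\<rho> 3) / (1 + ?x + ?\<rho> 3)"
        using rho_add_2[OF t(1), of "2 * h + 1"] rho_add_2[OF t(1), of "2 * h + 3"]
        by (simp_all add: numeral_eq_Suc)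
      show "(real h + 1) * ((real h + 1 + 3) * ?x + ?\<rho> 1 + ?\<rho> 3) = 1"
        using root by (simp add: pretzel_equation_def add_ac)
    qed (use t rho_nonneg in auto)
    then show ?thesis by (simp add: pretzel_equation_def add_ac)
  qed
  ultimately show False by simp
qed

end
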